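(* Let $n\ge 2$ and $m\ge 1$ be integers. Let $F:\mathbb{B}^n\to\mathbb{R}^{m+1}$ be a harmonic mapping such that $F(\mathbb{B}^n)\subset\mathbb{B}^{m+1}$ and $F(0)=0$. Then $$|F(x)|\le U(|x|N)$$ for every $x\in\mathbb{B}^n$, where $U$ is the Poisson integral of the function on $S$ that equals $1$ on $S^+$ and $-1$ on $S^-$. Equality holds for some nonzero $x_0\in\mathbb{B}^n$ if and only if $F(x)=U(xA)e$ for all $x\in\mathbb{B}^n$, where $A$ is an orthogonal $n\times n$ matrix such that $x_0A=|x_0|N$ and $e$ is a unit vector in $\mathbb{R}^{m+1}$ (that is, for a given nonzero $x_0$, equality holds at $x_0$ if and only if $F$ has this form for some such $A$ and $e$).
   Context: Vectors are row vectors and matrices act on the right. $\mathbb{B}^k$ is the open unit ball of $\mathbb{R}^k$, $S$ is the unit sphere in $\mathbb{R}^n$, $\sigma$ is surface-area measure on $S$ normalized so that $\sigma(S)=1$, $N=(0,\dots,0,1)\in S$, $S^+=\{x\in S:x_n>0\}$ and $S^-=\{x\in S:x_n<0\}$. A mapping into $\mathbb{R}^{m+1}$ is harmonic if each of its components is $C^2$ with zero Laplacian. The Poisson integral of a bounded measurable function $f$ on $S$ is $x\mapsto\int_S\frac{1-|x|^2}{|x-\omega|^n}f(\omega)\,d\sigma(\omega)$, $x\in\mathbb{B}^n$. *)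

theory Defs
  imports "HOL-Analysis.Analysis"
begin

definition partial_deriv :: "'n::finite \<Rightarrow> (real^'n \<Rightarrow> real) \<Rightarrow> real^'n \<Rightarrow> real"
  where "partial_deriv i f x = frechet_derivative f (at x) (axis i 1)"

(* On an open set this is the usual class C^2: a function whose first partial derivatives
   are C^1 is differentiable, and conversely. Requiring differentiability of f and of its
   first partial derivatives also ensures that every frechet_derivative involved in the
   second partial derivatives is a genuine derivative. *)
definition C2_on :: "(real^'n::finite) set \<Rightarrow> (real^'n \<Rightarrow> real) \<Rightarrow> bool"
  where "C2_on S f \<longleftrightarrow>
    (\<forall>x\<in>S. f differentiable (at x)) \<and>
    (\<forall>i. \<forall>x\<in>S. partial_deriv i f differentiable (at x)) \<and>
    (\<forall>i j. continuous_on S (partial_deriv j (partial_deriv i f)))"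

definition laplacian :: "(real^'n::finite \<Rightarrow> real) \<Rightarrow> real^'n \<Rightarrow> real"
  where "laplacian f x = (\<Sum>i\<in>UNIV. partial_deriv i (partial_deriv i f) x)"

definition harmonic_mapping_on :: "(real^'n::finite) set \<Rightarrow> (real^'n \<Rightarrow> real^'k::finite) \<Rightarrow> bool"
  where "harmonic_mapping_on S F \<longleftrightarrow>
    (\<forall>j. C2_on S (\<lambda>x. F x $ j) \<and> (\<forall>x\<in>S. laplacian (\<lambda>x. F x $ j) x = 0))"

(* Normalized surface area measure on the unit sphere, as the polar-coordinate measure:
   the measure of a Borel set E of the sphere is the proportion of the unit ball occupied
   by the cone over E. The lemmas below state this explicitly, together with normalization
   and invariance under orthogonal maps, which determine the measure uniquely. *)
definition sphere_measure :: "(real^'n::finite) measure"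
  where "sphere_measure =
    restrict_space (distr (uniform_measure lborel (ball 0 1)) borel sgn) (sphere 0 1)"

(* The coordinates are numbered by a linearly ordered finite index type (class wellorder, which
   for finite types adds nothing to linorder); its maximum is the last coordinate. *)
abbreviation last_index :: "'n::{finite,wellorder}"
  where "last_index \<equiv> Max UNIV"

definition north_pole :: "real^'n::{finite,wellorder}"
  where "north_pole = axis last_index 1"

definition upper_hemisphere :: "(real^'n::{finite,wellorder}) set"
  where "upper_hemisphere = {x \<in> sphere 0 1. x $ last_index > 0}"

definition lower_hemisphere :: "(real^'n::{finite,wellorder}) set"
  where "lower_hemisphere = {x \<in> sphere 0 1. x $ last_index < 0}"

definition poisson_integral :: "(real^'n::finite \<Rightarrow> real) \<Rightarrow> real^'n \<Rightarrow> real"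
  where "poisson_integral f x =
    (LINT \<omega>|sphere_measure. (1 - (norm x)\<^sup>2) / norm (x - \<omega>) ^ CARD('n) * f \<omega>)"

(* The value 0 on the equator is immaterial, the equator being a null set. *)
definition hemisphere_poisson :: "real^'n::{finite,wellorder} \<Rightarrow> real"
  where "hemisphere_poisson =
    poisson_integral (\<lambda>\<omega>. if \<omega> \<in> upper_hemisphere then 1
                          else if \<omega> \<in> lower_hemisphere then - 1 else 0)"

lemma space_sphere_measure: "space (sphere_measure :: (real^'n::finite) measure) = sphere 0 1"
  by (simp add: sphere_measure_def space_restrict_space)

lemma sets_sphere_measure:
  "sets (sphere_measure :: (real^'n::finite) measure) = sets (restrict_space borel (sphere 0 1))"
  by (simp add: sphere_measure_def sets_restrict_space)

lemma sphere_cone_eq: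
  fixes E :: "(real^'n::finite) set"
  assumes "E \<subseteq> sphere 0 1"
  shows "{r *\<^sub>R \<omega> |r \<omega>. 0 < r \<and> r < 1 \<and> \<omega> \<in> E} = ball 0 1 \<inter> sgn -` E" (is "?L = ?R")
proof
  show "?L \<subseteq> ?R"
    using assms by (auto simp: sgn_div_norm)
  show "?R \<subseteq> ?L"
  proof
    fix x assume x: "x \<in> ?R"
    then have "x \<noteq> 0" using assms by auto
    moreover have "x = norm x *\<^sub>R sgn x"
      using \<open>x \<noteq> 0\<close> by (simp add: sgn_div_norm)
    ultimately show "x \<in> ?L" using x by force
  qed
qed

lemma emeasure_sphere_measure:
  fixes E :: "(real^'n::finite) set"
  assumes E: "E \<in> sets sphere_measure"
  shows "emeasure sphere_measure E =
    emeasure lborel {r *\<^sub>R \<omega> |r \<omega>. 0 < r \<and> r < 1 \<and> \<omega> \<in> E} / emeasure lborel (ball 0 1 :: (real^'n) set)"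
proof -
  have sub: "E \<subseteq> sphere 0 1" and bor: "E \<in> sets borel"
    using E by (auto simp: sets_sphere_measure sets_restrict_space)
  have "emeasure sphere_measure E = emeasure (uniform_measure lborel (ball 0 1)) (sgn -` E)"
    unfolding sphere_measure_def
    using sub bor by (simp add: emeasure_restrict_space emeasure_distr)
  also have "\<dots> = emeasure lborel (ball 0 1 \<inter> sgn -` E) / emeasure lborel (ball 0 1 :: (real^'n) set)"
    using bor measurable_sets[OF borel_measurable_sgn bor] by (intro emeasure_uniform_measure) auto
  finally show ?thesis
    by (simp only: sphere_cone_eq[OF sub])
qed

lemma emeasure_sphere_measure_sphere: "emeasure sphere_measure (sphere 0 1 :: (real^'n::finite) set) = 1"
proof -
  let ?S = "sphere 0 1 :: (real^'n) set"
  let ?B = "ball 0 1 :: (real^'n) set"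
  have sets: "?S \<in> sets sphere_measure"
    by (metis sets.top space_sphere_measure)
  have "?B \<inter> sgn -` ?S = ?B - {0}"
    by (auto simp: norm_sgn split: if_splits)
  moreover have "emeasure lborel (?B - {0}) = emeasure lborel ?B"
    by (rule emeasure_Diff_null_set) auto
  ultimately have "emeasure sphere_measure ?S = emeasure lborel ?B / emeasure lborel ?B"
    by (simp only: emeasure_sphere_measure[OF sets] sphere_cone_eq[OF order_refl])
  also have "\<dots> = 1"
  proof (rule ennreal_divide_self)
    show "emeasure lborel ?B \<noteq> 0"
      using content_ball_pos[of 1 "0 :: real^'n"] by (auto simp: measure_def)
    show "emeasure lborel ?B < top"
      using emeasure_bounded_finite[OF bounded_ball] by simp
  qed
  finally show ?thesis .
qed

lemma sphere_measure_orthogonal_image: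
  fixes T :: "real^'n::{finite,wellorder} \<Rightarrow> real^'n::_"
  assumes T: "orthogonal_transformation T" and E: "E \<in> sets sphere_measure"
  shows "T ` E \<in> sets sphere_measure"
    and "emeasure sphere_measure (T ` E) = emeasure sphere_measure E"
proof -
  have sub: "E \<subseteq> sphere 0 1" and bor: "E \<in> sets borel"
    using E by (auto simp: sets_sphere_measure sets_restrict_space)
  have lin: "linear T" and bij: "bij T" and linv: "linear (inv T)"
    using T by (auto simp: orthogonal_transformation_linear orthogonal_transformation_bij
        orthogonal_transformation_inv)
  have "inv T \<in> borel_measurable borel"
    using linv by (intro borel_measurable_continuous_onI linear_continuous_on)
      (simp add: linear_conv_bounded_linear)
  then have "inv T -` E \<in> sets borel"
    using measurable_sets[OF _ bor, of "inv T" borel] by simp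
  then have borT: "T ` E \<in> sets borel"
    using bij by (simp add: bij_vimage_eq_inv_image bij_imp_bij_inv inv_inv_eq)
  have subT: "T ` E \<subseteq> sphere 0 1"
    using sub T by (auto simp: orthogonal_transformation_norm)
  show setsT: "T ` E \<in> sets sphere_measure"
    using subT borT by (auto simp: sets_sphere_measure sets_restrict_space)
  let ?C = "\<lambda>D. {r *\<^sub>R \<omega> |r \<omega>. 0 < r \<and> r < 1 \<and> \<omega> \<in> D} :: (real^'n::_) set"
  have borC: "?C D \<in> sets borel" and finC: "emeasure lborel (?C D) \<noteq> \<infinity>"
    if "D \<subseteq> sphere 0 1" "D \<in> sets borel" for D
  proof -
    show "?C D \<in> sets borel"
      using measurable_sets[OF borel_measurable_sgn that(2)] by (simp add: sphere_cone_eq[OF that(1)])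
    have "bounded (?C D)"
      using bounded_subset[OF bounded_ball] by (simp add: sphere_cone_eq[OF that(1)] bounded_Int)
    then show "emeasure lborel (?C D) \<noteq> \<infinity>"
      using emeasure_bounded_finite by fastforce
  qed
  have "?C E \<in> lmeasurable"
    using borC[OF sub bor] finC[OF sub bor] by (intro fmeasurableI) (auto simp: less_top)
  moreover have "?C (T ` E) = T ` ?C E"
    using lin by (fastforce simp: linear_scale image_iff)
  ultimately have "measure lebesgue (?C (T ` E)) = measure lebesgue (?C E)"
    using measure_orthogonal_image[OF T] by simp
  then have "measure lborel (?C (T ` E)) = measure lborel (?C E)"
    using borC[OF sub bor] borC[OF subT borT] by simp
  then have "emeasure lborel (?C (T ` E)) = emeasure lborel (?C E)"
    using finC[OF sub bor] finC[OF subT borT] by (simp add: emeasure_eq_ennreal_measure)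
  then show "emeasure sphere_measure (T ` E) = emeasure sphere_measure E"
    by (simp only: emeasure_sphere_measure[OF E] emeasure_sphere_measure[OF setsT])
qed

end

theory Submission
  imports Defs
begin

text \<open>
  A function \<open>u\<close> that is harmonic in the ball and continuous up to the sphere is the Poisson
  integral of its boundary values: Poisson integrals are locally uniform limits of finite sums of
  Poisson kernels, so the maximum principle holds for the difference of the two, which is
  uniformly small near the sphere.

  Apply this to the dilation \<open>u\<^sub>r(x) = u(r x)\<close> of a harmonic \<open>u\<close> with \<open>\<bar>u\<bar> \<le> 1\<close> and \<open>u(0) = 0\<close>.
  Let \<open>s(w)\<close> be the sign of \<open>x \<bullet> w\<close> and \<open>c\<close> the value of \<open>P(x, w)\<close> on the equator \<open>x \<bullet> w = 0\<close>. As \<open>s\<close>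
  and \<open>u\<^sub>r\<close> both have mean zero, and \<open>P(x, w) - c\<close> has the sign \<open>s(w)\<close>, the Poisson integral of \<open>s\<close>
  at \<open>x\<close> exceeds \<open>u(r x)\<close> by the integral of \<open>\<bar>P(x, w) - c\<bar> \<bar>s(w) - u\<^sub>r(w)\<bar>\<close>. This is the bound. In
  case of equality at \<open>x\<close> the integral tends to \<open>0\<close> as \<open>r\<close> tends to \<open>1\<close>, so \<open>u\<^sub>r\<close> tends to \<open>s\<close> almost
  everywhere along a sequence. For a mapping \<open>F\<close>, take \<open>u = e \<bullet> F\<close> with \<open>e\<close> the direction of
  \<open>F(x)\<close>; since \<open>\<bar>F\<bar> \<le> 1\<close>, it follows that \<open>F(r w)\<close> tends to \<open>s(w) e\<close>, and dominated convergence
  in the Poisson formula determines \<open>F\<close>.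
\<close>

subsection \<open>The maximum principle\<close>

text \<open>Only derivatives along coordinate lines are involved: the maximum principle needs no more.\<close>
definition has_laplacian :: "(real^'n::finite \<Rightarrow> real) \<Rightarrow> real \<Rightarrow> real^'n \<Rightarrow> bool"
  where "has_laplacian f L x \<longleftrightarrow> (\<exists>g' d.
    (\<forall>i. (\<forall>\<^sub>F t in nhds 0. ((\<lambda>t. f (x + t *\<^sub>R axis i 1)) has_real_derivative g' i t) (at t)) \<and>
         (g' i has_real_derivative d i) (at 0)) \<and>
    L = (\<Sum>i\<in>UNIV. d i))"

lemma has_laplacianI:
  assumes "\<And>i. \<forall>\<^sub>F t in nhds 0. ((\<lambda>t. f (x + t *\<^sub>R axis i 1)) has_real_derivative g' i t) (at t)"
    and "\<And>i. (g' i has_real_derivative d i) (at 0)"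
    and "L = (\<Sum>i\<in>UNIV. d i)"
  shows "has_laplacian f L x"
  using assms unfolding has_laplacian_def by blast

lemma has_laplacian_add:
  assumes "has_laplacian f L x" "has_laplacian g K x"
  shows "has_laplacian (\<lambda>x. f x + g x) (L + K) x"
proof -
  obtain f' d where f: "\<And>i. \<forall>\<^sub>F t in nhds 0. ((\<lambda>t. f (x + t *\<^sub>R axis i 1)) has_real_derivative f' i t) (at t)"
    "\<And>i. (f' i has_real_derivative d i) (at 0)" "L = (\<Sum>i\<in>UNIV. d i)"
    using assms(1) unfolding has_laplacian_def by blast
  obtain g' e where g: "\<And>i. \<forall>\<^sub>F t in nhds 0. ((\<lambda>t. g (x + t *\<^sub>R axis i 1)) has_real_derivative g' i t) (at t)"
    "\<And>i. (g' i has_real_derivative e i) (at 0)" "K = (\<Sum>i\<in>UNIV. e i)"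
    using assms(2) unfolding has_laplacian_def by blast
  show ?thesis
  proof (rule has_laplacianI)
    show "\<forall>\<^sub>F t in nhds 0. ((\<lambda>t. f (x + t *\<^sub>R axis i 1) + g (x + t *\<^sub>R axis i 1))
        has_real_derivative f' i t + g' i t) (at t)" for i
      using f(1)[of i] g(1)[of i] by eventually_elim (rule DERIV_add)
    show "((\<lambda>t. f' i t + g' i t) has_real_derivative d i + e i) (at 0)" for i
      using f(2) g(2) by (rule DERIV_add)
    show "L + K = (\<Sum>i\<in>UNIV. d i + e i)"
      by (simp add: f g sum.distrib)
  qed
qed

lemma has_laplacian_cmult:
  assumes "has_laplacian f L x"
  shows "has_laplacian (\<lambda>x. c * f x) (c * L) x"
proof -
  obtain f' d where f: "\<And>i. \<forall>\<^sub>F t in nhds 0. ((\<lambda>t. f (x + t *\<^sub>R axis i 1)) has_real_derivative f' i t) (at t)"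
    "\<And>i. (f' i has_real_derivative d i) (at 0)" "L = (\<Sum>i\<in>UNIV. d i)"
    using assms(1) unfolding has_laplacian_def by blast
  show ?thesis
  proof (rule has_laplacianI)
    show "\<forall>\<^sub>F t in nhds 0. ((\<lambda>t. c * f (x + t *\<^sub>R axis i 1)) has_real_derivative c * f' i t) (at t)" for i
      using f(1)[of i] by eventually_elim (rule DERIV_cmult)
    show "((\<lambda>t. c * f' i t) has_real_derivative c * d i) (at 0)" for i
      using f(2) by (rule DERIV_cmult)
    show "c * L = (\<Sum>i\<in>UNIV. c * d i)"
      by (simp add: f sum_distrib_left)
  qed
qed

lemma has_laplacian_const: "has_laplacian (\<lambda>x. c) 0 x"
  by (rule has_laplacianI[where g' = "\<lambda>i t. 0" and d = "\<lambda>i. 0"]) auto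

lemma has_laplacian_sum:
  assumes "finite I" "\<And>i. i \<in> I \<Longrightarrow> has_laplacian (f i) 0 x"
  shows "has_laplacian (\<lambda>x. \<Sum>i\<in>I. f i x) 0 x"
  using assms
proof (induction I rule: finite_induct)
  case empty
  then show ?case by (simp add: has_laplacian_const)
next
  case (insert i I)
  then show ?case using has_laplacian_add[of "f i" 0 x "\<lambda>x. \<Sum>i\<in>I. f i x" 0] by simp
qed

lemma has_laplacian_diff:
  assumes "has_laplacian f L x" "has_laplacian g K x"
  shows "has_laplacian (\<lambda>x. f x - g x) (L - K) x"
  using has_laplacian_add[OF assms(1) has_laplacian_cmult[OF assms(2), of "-1"]] by simp

text \<open>Chain rule on each coordinate line. With \<open>L = 0\<close> it shows that dilations of
  harmonic functions are harmonic.\<close>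

lemma has_laplacian_scaled:
  assumes "has_laplacian f L (r *\<^sub>R x)"
  shows "has_laplacian (\<lambda>x. f (r *\<^sub>R x)) (r\<^sup>2 * L) x"
proof -
  obtain f' d where f: "\<And>i. \<forall>\<^sub>F t in nhds 0. ((\<lambda>t. f (r *\<^sub>R x + t *\<^sub>R axis i 1)) has_real_derivative f' i t) (at t)"
    "\<And>i. (f' i has_real_derivative d i) (at 0)" "L = (\<Sum>i\<in>UNIV. d i)"
    using assms(1) unfolding has_laplacian_def by blast
  have lim: "filterlim (\<lambda>t. r * t) (nhds 0) (nhds (0::real))"
    by (rule tendsto_eq_intros filterlim_ident refl | simp)+
  show ?thesis
  proof (rule has_laplacianI)
    fix i
    have "\<forall>\<^sub>F t in nhds 0. ((\<lambda>t. f (r *\<^sub>R x + t *\<^sub>R axis i 1)) has_real_derivative f' i (r * t)) (at (r * t))"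
      using eventually_compose_filterlim[OF f(1) lim] .
    then show "\<forall>\<^sub>F t in nhds 0. ((\<lambda>t. f (r *\<^sub>R (x + t *\<^sub>R axis i 1))) has_real_derivative f' i (r * t) * r) (at t)"
    proof eventually_elim
      case (elim t)
      have "((\<lambda>t. r * t) has_real_derivative r) (at t)"
        by (auto intro!: derivative_eq_intros)
      from DERIV_chain2[OF elim this] show ?case
        by (simp add: algebra_simps)
    qed
    have "((\<lambda>t. r * t) has_real_derivative r) (at 0)"
      by (auto intro!: derivative_eq_intros)
    then have "((\<lambda>t. f' i (r * t)) has_real_derivative d i * r) (at 0)"
      by (intro DERIV_chain2) (use f(2) in auto)
    then show "((\<lambda>t. f' i (r * t) * r) has_real_derivative d i * r * r) (at 0)"
      by (rule DERIV_cmult_right)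
    show "r\<^sup>2 * L = (\<Sum>i\<in>UNIV. d i * r * r)"
      by (simp add: f sum_distrib_left power2_eq_square mult_ac)
  qed
qed

lemma norm_add_axis_sq:
  fixes x :: "real^'n::finite"
  shows "(norm (x + t *\<^sub>R axis i 1))\<^sup>2 = (norm x)\<^sup>2 + 2 * x $ i * t + t\<^sup>2"
  unfolding power2_norm_eq_inner
  by (simp add: inner_simps inner_axis inner_axis' algebra_simps power2_eq_square inner_commute)

lemma has_laplacian_norm_sq:
  fixes x :: "real^'n::finite"
  shows "has_laplacian (\<lambda>x. (norm x)\<^sup>2) (2 * CARD('n)) x"
proof (rule has_laplacianI)
  show "\<forall>\<^sub>F t in nhds 0. ((\<lambda>t. (norm (x + t *\<^sub>R axis i 1))\<^sup>2) has_real_derivative 2 * x $ i + 2 * t) (at t)" for i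
    unfolding norm_add_axis_sq by (intro always_eventually allI) (auto intro!: derivative_eq_intros)
  show "((\<lambda>t. 2 * x $ i + 2 * t) has_real_derivative 2) (at 0)" for i
    by (auto intro!: derivative_eq_intros)
qed simp

text \<open>If \<open>d\<close> were positive, \<open>g'\<close>, which vanishes at the maximum,
  would be positive just to the right of 0, and by the mean value theorem \<open>g\<close> would
  exceed \<open>g 0\<close> there.\<close>

lemma second_deriv_nonpos_at_local_max:
  fixes g g' :: "real \<Rightarrow> real"
  assumes d1: "\<forall>\<^sub>F t in nhds 0. (g has_real_derivative g' t) (at t)"
    and d2: "(g' has_real_derivative d) (at 0)"
    and mx: "\<forall>\<^sub>F t in nhds 0. g t \<le> g 0"
  shows "d \<le> 0"
proof (rule ccontr)
  assume "\<not> d \<le> 0"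
  obtain e where e: "e > 0" "\<And>t. \<bar>t\<bar> < e \<Longrightarrow> (g has_real_derivative g' t) (at t)"
    "\<And>t. \<bar>t\<bar> < e \<Longrightarrow> g t \<le> g 0"
    using eventually_conj[OF d1 mx] unfolding eventually_nhds_metric by (auto simp: dist_real_def)
  have "g' 0 = 0"
    by (rule DERIV_local_max[of g "g' 0" 0 e]) (use e in auto)
  obtain e2 where e2: "e2 > 0" "\<And>h. 0 < h \<Longrightarrow> h < e2 \<Longrightarrow> g' 0 < g' h"
    using has_real_derivative_pos_inc_right[OF d2] \<open>\<not> d \<le> 0\<close> by auto
  define h where "h = min e e2 / 2"
  have h: "0 < h" "h < e" "h < e2" using e(1) e2(1) by (auto simp: h_def min_def)
  obtain z where z: "0 < z" "z < h" "g h - g 0 = (h - 0) * g' z"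
    using MVT2[of 0 h g g'] h e(2) by auto
  have "g' z > 0" using e2(2)[of z] z h \<open>g' 0 = 0\<close> by auto
  then have "g h - g 0 > 0" using z(3) h(1) by simp
  then show False using e(3)[of h] h by auto
qed

lemma has_laplacian_nonpos_at_local_max:
  assumes "has_laplacian f L x" and mx: "\<forall>\<^sub>F y in nhds x. f y \<le> f x"
  shows "L \<le> 0"
proof -
  obtain f' d where f: "\<And>i. \<forall>\<^sub>F t in nhds 0. ((\<lambda>t. f (x + t *\<^sub>R axis i 1)) has_real_derivative f' i t) (at t)"
    "\<And>i. (f' i has_real_derivative d i) (at 0)" "L = (\<Sum>i\<in>UNIV. d i)"
    using assms(1) unfolding has_laplacian_def by blast
  have "d i \<le> 0" for i
  proof -
    have "filterlim (\<lambda>t. x + t *\<^sub>R axis i 1) (nhds x) (nhds (0::real))"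
      by (rule tendsto_eq_intros filterlim_ident refl | simp)+
    from eventually_compose_filterlim[OF mx this] show ?thesis
      by (intro second_deriv_nonpos_at_local_max[OF f(1) f(2)]) simp
  qed
  then show ?thesis by (simp add: f(3) sum_nonpos)
qed

text \<open>Adding \<open>k * (norm y)\<^sup>2\<close> makes the Laplacian strictly positive, so a
  maximum of the sum cannot be interior. It lies on the sphere, where the added term is at most
  \<open>e\<close>.\<close>

lemma maximum_principle:
  fixes f :: "real^'n::finite \<Rightarrow> real"
  assumes cont: "continuous_on (cball 0 \<rho>) f"
    and lap: "\<And>x. x \<in> ball 0 \<rho> \<Longrightarrow> has_laplacian f 0 x"
    and bd: "\<And>x. x \<in> sphere 0 \<rho> \<Longrightarrow> f x \<le> M" and x: "x \<in> cball 0 \<rho>"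
  shows "f x \<le> M"
proof (rule field_le_epsilon)
  fix e :: real assume e: "e > 0"
  have \<rho>: "0 \<le> \<rho>" using x norm_ge_zero[of x] by (simp del: norm_ge_zero)
  \<comment> \<open>Chosen so that \<open>k * \<rho>\<^sup>2 \<le> e\<close>; the summand 1 covers
    \<open>\<rho> = 0\<close>.\<close>
  define k where "k = e / (1 + \<rho>\<^sup>2)"
  have k: "k > 0" using e by (simp add: k_def add_pos_nonneg)
  have ke: "k * \<rho>\<^sup>2 \<le> e" using e by (simp add: k_def field_simps add_pos_nonneg)
  let ?h = "\<lambda>y. f y + k * (norm y)\<^sup>2"
  have "continuous_on (cball 0 \<rho>) ?h" by (intro continuous_intros cont)
  then obtain z where z: "z \<in> cball 0 \<rho>" "\<And>y. y \<in> cball 0 \<rho> \<Longrightarrow> ?h y \<le> ?h z"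
    using continuous_attains_sup[of "cball 0 \<rho>" ?h] \<rho> by auto
  have "z \<notin> ball 0 \<rho>"
  proof
    assume zb: "z \<in> ball 0 \<rho>"
    have "has_laplacian ?h (0 + k * (2 * CARD('n))) z"
      by (intro has_laplacian_add has_laplacian_cmult has_laplacian_norm_sq lap zb)
    moreover have "\<forall>\<^sub>F y in nhds z. ?h y \<le> ?h z"
      using z(2) ball_subset_cball zb unfolding eventually_nhds by (meson open_ball subsetD)
    ultimately have "0 + k * (2 * CARD('n)) \<le> 0" by (rule has_laplacian_nonpos_at_local_max)
    then show False using k by (simp add: mult_le_0_iff)
  qed
  then have "z \<in> sphere 0 \<rho>" using z(1) by auto
  then have "?h z \<le> M + k * \<rho>\<^sup>2" using bd by auto
  moreover have "f x \<le> ?h x" using k by auto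
  ultimately show "f x \<le> M + e" using z(2)[OF x] ke by linarith
qed

text \<open>Passes from the Frechet derivatives in the definition of harmonic mappings to
  derivatives along coordinate lines, where the tools above apply.\<close>

lemma has_laplacian_harmonic_component:
  fixes F :: "real^'n::finite \<Rightarrow> real^'k::finite"
  assumes "harmonic_mapping_on S F" "open S" "x \<in> S"
  shows "has_laplacian (\<lambda>x. F x $ j) 0 x"
proof (rule has_laplacianI)
  let ?f = "\<lambda>x. F x $ j"
  have d1: "\<And>y. y \<in> S \<Longrightarrow> ?f differentiable (at y)"
    and d2: "\<And>y i. y \<in> S \<Longrightarrow> partial_deriv i ?f differentiable (at y)"
    and L: "laplacian ?f x = 0"
    using assms unfolding harmonic_mapping_on_def C2_on_def by blast+
  have line: "((\<lambda>t. g (x + t *\<^sub>R axis i 1)) has_real_derivative partial_deriv i g (x + t *\<^sub>R axis i 1)) (at t)"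
    if "g differentiable (at (x + t *\<^sub>R axis i 1))" for g i t
  proof -
    have 1: "((\<lambda>t. x + t *\<^sub>R axis i 1) has_derivative (\<lambda>h. h *\<^sub>R axis i 1)) (at t)"
      by (auto intro!: derivative_eq_intros)
    have D: "(g has_derivative frechet_derivative g (at (x + t *\<^sub>R axis i 1))) (at (x + t *\<^sub>R axis i 1))"
      using that frechet_derivative_works by blast
    then have "linear (frechet_derivative g (at (x + t *\<^sub>R axis i 1)))"
      by (rule has_derivative_linear)
    then have "frechet_derivative g (at (x + t *\<^sub>R axis i 1)) (h *\<^sub>R axis i 1) = partial_deriv i g (x + t *\<^sub>R axis i 1) * h" for h
      by (simp add: partial_deriv_def linear_scale)
    with has_derivative_compose[OF 1 D] show ?thesis
      by (simp add: has_field_derivative_def)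
  qed
  show "\<forall>\<^sub>F t in nhds 0. ((\<lambda>t. ?f (x + t *\<^sub>R axis i 1)) has_real_derivative partial_deriv i ?f (x + t *\<^sub>R axis i 1)) (at t)" for i
  proof -
    have "filterlim (\<lambda>t. x + t *\<^sub>R axis i 1) (nhds x) (nhds (0::real))"
      by (rule tendsto_eq_intros filterlim_ident refl | simp)+
    from eventually_compose_filterlim[OF eventually_nhds_in_open[OF assms(2,3)] this]
    show ?thesis by eventually_elim (intro line d1)
  qed
  show "((\<lambda>t. partial_deriv i ?f (x + t *\<^sub>R axis i 1)) has_real_derivative partial_deriv i (partial_deriv i ?f) x) (at 0)" for i
    using line[of "partial_deriv i ?f" 0 i] d2[OF assms(3)] by simp
  show "0 = (\<Sum>i\<in>UNIV. partial_deriv i (partial_deriv i ?f) x)"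
    using L by (simp add: laplacian_def)
qed

subsection \<open>The Poisson kernel\<close>

definition poisson_kernel :: "real^'n::finite \<Rightarrow> real^'n \<Rightarrow> real"
  where "poisson_kernel x \<omega> = (1 - (norm x)\<^sup>2) / norm (x - \<omega>) ^ CARD('n)"

text \<open>A direct computation. On a coordinate line the kernel is
  \<open>(1 - a) * b powr (- p)\<close> with quadratic polynomials \<open>a\<close> and
  \<open>b\<close> in \<open>t\<close>; the sum of the second derivatives has a factor that vanishes
  because \<open>norm \<omega> = 1\<close>.\<close>

lemma has_laplacian_poisson_kernel:
  fixes x \<omega> :: "real^'n::finite"
  assumes w: "norm \<omega> = 1" and x: "x \<noteq> \<omega>"
  shows "has_laplacian (\<lambda>x. poisson_kernel x \<omega>) 0 x"
proof (rule has_laplacianI)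
  \<comment> \<open>Half the dimension, as \<open>b\<close> is a squared distance:
    \<open>b powr p\<close> is then the denominator of the kernel.\<close>
  define p where "p = real CARD('n) / 2"
  define a where "a = (\<lambda>i t. (norm x)\<^sup>2 + 2 * x $ i * t + t\<^sup>2)"
  define b where "b = (\<lambda>i t. (norm (x - \<omega>))\<^sup>2 + 2 * (x - \<omega>) $ i * t + t\<^sup>2)"
  define f' where "f' = (\<lambda>i t. - (2 * x $ i + 2 * t) * b i t powr (- p)
     - (1 - a i t) * (p * b i t powr (- p - 1) * (2 * (x - \<omega>) $ i + 2 * t)))"
  define B where "B = (norm (x - \<omega>))\<^sup>2"
  have B: "B > 0" using x by (simp add: B_def)
  have b0: "b i 0 = B" for i by (simp add: b_def B_def)
  have contb: "isCont (b i) t" for i t unfolding b_def by (intro continuous_intros)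
  have evb: "\<forall>\<^sub>F t in nhds 0. b i t > 0" for i
    using B b0[of i] contb[of 0 i] tendsto_at_iff_tendsto_nhds[of "b i" 0]
    by (intro order_tendstoD(1)[of "b i" B]) (auto simp: isCont_def)
  have ker: "poisson_kernel (x + t *\<^sub>R axis i 1) \<omega> = (1 - a i t) * b i t powr (- p)" if "b i t > 0" for i t
  proof -
    have b: "(norm (x + t *\<^sub>R axis i 1 - \<omega>))\<^sup>2 = b i t"
      using norm_add_axis_sq[where x = "x - \<omega>" and t = t and i = i] by (simp add: b_def algebra_simps)
    have pos: "norm (x + t *\<^sub>R axis i 1 - \<omega>) > 0" using that b by fastforce
    have "b i t powr p = (norm (x + t *\<^sub>R axis i 1 - \<omega>) powr 2) powr p"
      using pos by (simp only: b[symmetric] powr_numeral)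
    also have "\<dots> = norm (x + t *\<^sub>R axis i 1 - \<omega>) powr real CARD('n)"
      by (simp only: powr_powr p_def) simp
    also have "\<dots> = norm (x + t *\<^sub>R axis i 1 - \<omega>) ^ CARD('n)"
      by (rule powr_realpow[OF pos])
    finally have "b i t powr p = norm (x + t *\<^sub>R axis i 1 - \<omega>) ^ CARD('n)" .
    then show ?thesis
      by (simp add: poisson_kernel_def norm_add_axis_sq a_def powr_minus divide_inverse)
  qed
  have da: "(a i has_real_derivative (2 * x $ i + 2 * t)) (at t)"
    and db: "(b i has_real_derivative (2 * (x - \<omega>) $ i + 2 * t)) (at t)" for i t
    unfolding a_def b_def by (auto intro!: derivative_eq_intros)
  have dpow: "((\<lambda>t. b i t powr q) has_real_derivative q * b i t powr (q - 1) * (2 * (x - \<omega>) $ i + 2 * t)) (at t)"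
    if "b i t > 0" for i t q
    using DERIV_fun_powr[OF db that, where r = q] by simp
  show "\<forall>\<^sub>F t in nhds 0. ((\<lambda>t. poisson_kernel (x + t *\<^sub>R axis i 1) \<omega>) has_real_derivative f' i t) (at t)" for i
    \<comment> \<open>To differentiate at \<open>t\<close>, the formula for the kernel must hold in
      a neighbourhood of \<open>t\<close>, so positivity of \<open>b i\<close> is needed around
      every \<open>t\<close> close to 0.\<close>
    using eventually_eventually[THEN iffD2, OF evb[of i]]
  proof eventually_elim
    case (elim t)
    then have bt: "b i t > 0" by (rule eventually_nhds_x_imp_x)
    have "((\<lambda>t. (1 - a i t) * b i t powr (- p)) has_real_derivative f' i t) (at t)"
      unfolding f'_def
      by (rule derivative_eq_intros da dpow[OF bt] refl)+ (simp add: algebra_simps)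
    moreover have "\<forall>\<^sub>F s in nhds t. poisson_kernel (x + s *\<^sub>R axis i 1) \<omega> = (1 - a i s) * b i s powr (- p)"
      using elim by eventually_elim (rule ker)
    ultimately show ?case by (simp add: DERIV_cong_ev[OF refl _ refl])
  qed
  \<comment> \<open>With names for these powers of the squared distance \<open>B\<close>, the
    identities to be checked become polynomial.\<close>
  define X where "X = B powr (- p)"
  define Y where "Y = B powr (- p - 1)"
  define Z where "Z = B powr (- p - 2)"
  define c where "c = 1 - (norm x)\<^sup>2"
  \<comment> \<open>Grouped as a constant, a multiple of \<open>x $ i * (x - \<omega>) $ i\<close>
    and a multiple of \<open>((x - \<omega>) $ i)\<^sup>2\<close>, so that summation over
    \<open>i\<close> produces an inner product and \<open>B\<close>.\<close>
  define d where "d = (\<lambda>i. (- 2 * X - c * 2 * p * Y) + 8 * p * Y * (x $ i * (x - \<omega>) $ i)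
    + c * 4 * p * (p + 1) * Z * ((x - \<omega>) $ i)\<^sup>2)"
  show "(f' i has_real_derivative d i) (at 0)" for i
  proof -
    have b1: "b i 0 > 0" using B b0 by simp
    define y where "y = (x - \<omega>) $ i"
    define q1 where "q1 = (\<lambda>t. b i t powr (- p))"
    define q2 where "q2 = (\<lambda>t. b i t powr (- p - 1))"
    have d1: "(q1 has_real_derivative - p * Y * (2 * y + 2 * 0)) (at 0)"
      using dpow[OF b1, of "- p"] unfolding b0 Y_def y_def q1_def .
    have d2: "(q2 has_real_derivative (- p - 1) * Z * (2 * y + 2 * 0)) (at 0)"
      using dpow[OF b1, of "- p - 1"] unfolding b0 Z_def y_def q2_def by (simp only: diff_diff_eq one_add_one)
    have at0: "a i 0 = (norm x)\<^sup>2" "q1 0 = X" "q2 0 = Y"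
      by (simp_all add: a_def q1_def q2_def X_def Y_def b0)
    have f': "f' i = (\<lambda>t. - (2 * x $ i + 2 * t) * q1 t - (1 - a i t) * (p * q2 t * (2 * y + 2 * t)))"
      by (simp add: f'_def q1_def q2_def y_def)
    show ?thesis
      unfolding f' d_def y_def[symmetric]
      apply (rule derivative_eq_intros da d1 d2 refl)+
      unfolding at0 c_def
      by algebra
  qed
  \<comment> \<open>Expressing \<open>X\<close> and \<open>Y\<close> through \<open>Z\<close> lets
    the factor \<open>B * Z\<close> be taken out of the sum.\<close>
  have "- p - 1 = 1 + (- p - 2)" "- p = 2 + (- p - 2)" by simp_all
  then have "B powr (- p - 1) = B powr 1 * B powr (- p - 2)" "B powr (- p) = B powr 2 * B powr (- p - 2)"
    by (metis powr_add)+
  then have Y: "Y = B * Z" and X: "X = B * B * Z"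
    using B by (simp_all add: X_def Y_def Z_def power2_eq_square)
  have s1: "(\<Sum>i\<in>UNIV. x $ i * (x - \<omega>) $ i) = inner x (x - \<omega>)"
    by (simp add: inner_vec_def)
  have s2: "(\<Sum>i\<in>UNIV. ((x - \<omega>) $ i)\<^sup>2) = B"
    unfolding B_def power2_norm_eq_inner by (simp add: inner_vec_def power2_eq_square)
  have "(\<Sum>i\<in>UNIV. d i) = CARD('n) * (- 2 * X - c * 2 * p * Y) + 8 * p * Y * inner x (x - \<omega>)
    + c * 4 * p * (p + 1) * Z * B"
    unfolding d_def s1[symmetric] s2[symmetric] sum.distrib sum_distrib_left by simp
  also have "real CARD('n) = 2 * p" by (simp add: p_def)
  finally have "(\<Sum>i\<in>UNIV. d i) = 4 * p * B * Z * (- B + 2 * inner x (x - \<omega>) + c)"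
    unfolding X Y by algebra
  \<comment> \<open>This is the expansion of the squared distance \<open>B\<close>, using
    \<open>norm \<omega> = 1\<close>.\<close>
  moreover have "- B + 2 * inner x (x - \<omega>) + c = 0"
  proof -
    have "inner \<omega> \<omega> = 1" using w by (simp add: norm_eq_1)
    then show ?thesis
      unfolding B_def c_def power2_norm_eq_inner by (simp add: inner_simps inner_commute)
  qed
  ultimately show "0 = (\<Sum>i\<in>UNIV. d i)" by simp
qed

subsection \<open>Poisson integrals\<close>

lemma borel_measurable_sphere_measureI:
  fixes f :: "real^'n::finite \<Rightarrow> 'b::topological_space"
  assumes "continuous_on (sphere 0 1) f"
  shows "f \<in> borel_measurable sphere_measure"
  using borel_measurable_continuous_on_restrict[OF assms]
  by (subst measurable_cong_sets[OF sets_sphere_measure refl])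

interpretation sphere: finite_measure "sphere_measure :: (real^'n::finite) measure"
  by (rule finite_measureI) (simp add: space_sphere_measure emeasure_sphere_measure_sphere)

lemma integrable_sphere_measureI:
  fixes f :: "real^'n::finite \<Rightarrow> real"
  assumes "f \<in> borel_measurable sphere_measure" "\<And>x. norm x = 1 \<Longrightarrow> \<bar>f x\<bar> \<le> B"
  shows "integrable sphere_measure f"
  by (rule sphere.integrable_const_bound[where B = B])
    (use assms in \<open>auto intro!: AE_I2 simp: space_sphere_measure\<close>)

section \<open>Invariance of the sphere measure under orthogonal maps\<close>

lemma orthogonal_transformation_measurable_sphere:
  fixes T :: "real^'n::finite \<Rightarrow> real^'n"
  assumes "orthogonal_transformation T"
  shows "T \<in> measurable sphere_measure sphere_measure"
proof -
  have "continuous_on UNIV T"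
    using orthogonal_transformation_linear[OF assms] linear_continuous_on linear_conv_bounded_linear by blast
  then have "T \<in> borel_measurable borel" by (rule borel_measurable_continuous_onI)
  then have "T \<in> measurable (restrict_space borel (sphere 0 1)) (restrict_space borel (sphere 0 1))"
    using assms by (intro measurable_restrict_space3) (auto simp: orthogonal_transformation_norm)
  then show ?thesis
    by (simp add: measurable_cong_sets[OF sets_sphere_measure sets_sphere_measure])
qed

text \<open>The preimage of a set under \<open>T\<close> is its image under \<open>inv T\<close>,
  which is again orthogonal, so the invariance known for images applies.\<close>

lemma distr_sphere_measure_orthogonal:
  fixes T :: "real^'n::{finite,wellorder} \<Rightarrow> real^'n::_"
  assumes T: "orthogonal_transformation T"
  shows "distr sphere_measure sphere_measure T = sphere_measure"
proof (rule measure_eqI)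
  fix E :: "(real^'n::_) set" assume "E \<in> sets (distr sphere_measure sphere_measure T)"
  then have E: "E \<in> sets sphere_measure" by simp
  then have sub: "E \<subseteq> sphere 0 1"
    using sets.sets_into_space space_sphere_measure by metis
  have bij: "bij T" and Ti: "orthogonal_transformation (inv T)"
    using T by (simp_all add: orthogonal_transformation_bij orthogonal_transformation_inv)
  have "T -` E \<inter> space sphere_measure = inv T ` E"
    using bij sub T by (auto simp: space_sphere_measure bij_vimage_eq_inv_image orthogonal_transformation_norm[OF Ti])
  then show "emeasure (distr sphere_measure sphere_measure T) E = emeasure sphere_measure E"
    using E sphere_measure_orthogonal_image(2)[OF Ti E]
    by (simp add: emeasure_distr orthogonal_transformation_measurable_sphere[OF T])
qed simp

lemma integral_sphere_orthogonal:
  fixes T :: "real^'n::{finite,wellorder} \<Rightarrow> real^'n::_" and f :: "real^'n::_ \<Rightarrow> real"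
  assumes T: "orthogonal_transformation T" and f: "f \<in> borel_measurable sphere_measure"
  shows "(LINT w|sphere_measure. f (T w)) = (LINT w|sphere_measure. f w)"
  using integral_distr[OF orthogonal_transformation_measurable_sphere[OF T] f]
  by (simp add: distr_sphere_measure_orthogonal[OF T])

section \<open>Estimates for the kernel and behaviour under rotations\<close>

lemma poisson_kernel_continuous:
  "continuous_on (ball 0 1 \<times> sphere 0 1) (\<lambda>(x, w). poisson_kernel x w)"
  unfolding poisson_kernel_def split_beta
  by (intro continuous_intros) auto

lemma poisson_kernel_continuous_sphere:
  assumes "norm x < 1"
  shows "continuous_on (sphere 0 1) (poisson_kernel x)"
  unfolding poisson_kernel_def by (intro continuous_intros) (use assms in auto)

lemma poisson_kernel_nonneg: "norm x < 1 \<Longrightarrow> poisson_kernel x w \<ge> 0"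
  by (auto simp: poisson_kernel_def abs_square_le_1 intro!: divide_nonneg_nonneg)

text \<open>\<open>d = 1 - norm x\<close> gives a bound uniform on the sphere; a fixed
  \<open>d\<close> shows that the kernel becomes small away from its pole as \<open>norm x\<close>
  tends to 1.\<close>

lemma poisson_kernel_le:
  fixes x w :: "real^'n::finite"
  assumes "norm x < 1" "0 < d" "d \<le> norm (x - w)"
  shows "poisson_kernel x w \<le> (1 - (norm x)\<^sup>2) / d ^ CARD('n)"
  unfolding poisson_kernel_def
  using assms by (intro divide_left_mono mult_pos_pos zero_less_power power_mono) (auto simp: abs_square_le_1)

lemma poisson_kernel_bounded:
  fixes x w :: "real^'n::finite"
  assumes "norm x < 1" "norm w = 1"
  shows "\<bar>poisson_kernel x w\<bar> \<le> (1 - (norm x)\<^sup>2) / (1 - norm x) ^ CARD('n)"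
  using poisson_kernel_nonneg[of x w] poisson_kernel_le[of x "1 - norm x" w] assms norm_triangle_ineq2[of w x]
  by (simp add: norm_minus_commute)

lemma poisson_integral_kernel:
  "poisson_integral f x = (LINT w|sphere_measure. poisson_kernel x w * f w)"
  by (simp add: poisson_integral_def poisson_kernel_def)

lemma integrable_poisson_kernel_mult:
  fixes f :: "real^'n::finite \<Rightarrow> real"
  assumes x: "norm x < 1" and f: "integrable sphere_measure f"
  shows "integrable sphere_measure (\<lambda>w. poisson_kernel x w * f w)"
proof (rule Bochner_Integration.integrable_bound)
  let ?C = "(1 - (norm x)\<^sup>2) / (1 - norm x) ^ CARD('n)"
  show "integrable sphere_measure (\<lambda>w. ?C * f w)" using f by simp
  show "(\<lambda>w. poisson_kernel x w * f w) \<in> borel_measurable sphere_measure"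
    by (intro borel_measurable_times borel_measurable_integrable[OF f] borel_measurable_sphere_measureI
        poisson_kernel_continuous_sphere x)
  have "norm (poisson_kernel x w * f w) \<le> norm (?C * f w)" if "norm w = 1" for w
    using mult_right_mono[OF order_trans[OF poisson_kernel_bounded[OF x that] abs_ge_self], of "\<bar>f w\<bar>"]
    by (simp only: abs_mult real_norm_def abs_ge_zero)
  then show "AE w in sphere_measure. norm (poisson_kernel x w * f w) \<le> norm (?C * f w)"
    by (intro AE_I2) (simp add: space_sphere_measure)
qed

lemma poisson_integral_uminus: "poisson_integral (\<lambda>w. - f w) x = - poisson_integral f x"
  by (simp add: poisson_integral_kernel)

lemma poisson_kernel_orthogonal:
  fixes T :: "real^'n::finite \<Rightarrow> real^'n"
  assumes "orthogonal_transformation T"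
  shows "poisson_kernel (T x) (T w) = poisson_kernel x w"
  using orthogonal_transformation_norm[OF assms] linear_diff[OF orthogonal_transformation_linear[OF assms], of x w]
  unfolding poisson_kernel_def by metis

lemma poisson_integral_orthogonal:
  fixes T :: "real^'n::{finite,wellorder} \<Rightarrow> real^'n::_"
  assumes T: "orthogonal_transformation T" and f: "f \<in> borel_measurable sphere_measure" and x: "norm x < 1"
  shows "poisson_integral f (T x) = poisson_integral (\<lambda>w. f (T w)) x"
proof -
  have "(\<lambda>w. poisson_kernel (T x) w * f w) \<in> borel_measurable sphere_measure"
    using x T by (intro borel_measurable_times borel_measurable_sphere_measureI poisson_kernel_continuous_sphere f)
      (auto simp: orthogonal_transformation_norm)
  from integral_sphere_orthogonal[OF T this] show ?thesis
    by (simp add: poisson_integral_kernel poisson_kernel_orthogonal[OF T])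
qed

text \<open>A substitute for differentiation under the integral sign.\<close>
lemma poisson_integral_sum_approx:
  fixes g :: "real^'n::finite \<Rightarrow> real"
  assumes g: "integrable sphere_measure g" and \<rho>: "\<rho> < 1" and e: "e > 0"
  obtains N :: nat and c p where "\<And>k. k < N \<Longrightarrow> norm (p k :: real^'n) = 1"
    "\<And>x. x \<in> cball 0 \<rho> \<Longrightarrow> \<bar>poisson_integral g x - (\<Sum>k<N. c k * poisson_kernel x (p k))\<bar> \<le> e"
proof -
  define G where "G = (LINT w|sphere_measure. \<bar>g w\<bar>)"
  have G: "G \<ge> 0" by (simp add: G_def)
  define e' where "e' = e / (1 + G)"
  have e': "e' > 0" and e'G: "e' * G \<le> e" using e G by (auto simp: e'_def field_simps)
  have "uniformly_continuous_on (cball 0 \<rho> \<times> sphere 0 1) (\<lambda>(x, w :: real^'n). poisson_kernel x w)"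
    by (intro compact_uniformly_continuous continuous_on_subset[OF poisson_kernel_continuous] compact_Times)
      (use \<rho> in auto)
  then obtain d where "d > 0" and d': "\<And>z z'. z \<in> cball 0 \<rho> \<times> sphere 0 1 \<Longrightarrow> z' \<in> cball 0 \<rho> \<times> sphere 0 1 \<Longrightarrow>
      dist z' z < d \<Longrightarrow> dist (case z' of (x, w :: real^'n) \<Rightarrow> poisson_kernel x w) (case z of (x, w) \<Rightarrow> poisson_kernel x w) < e'"
    unfolding uniformly_continuous_on_def using e' by metis
  have d: "d > 0" "\<And>x w v :: real^'n. x \<in> cball 0 \<rho> \<Longrightarrow> norm w = 1 \<Longrightarrow> norm v = 1 \<Longrightarrow> dist w v < d \<Longrightarrow>
      \<bar>poisson_kernel x w - poisson_kernel x v\<bar> < e'"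
    subgoal using \<open>d > 0\<close> .
    subgoal for x w v using d'[of "(x, v)" "(x, w)"] by (simp add: dist_Pair_Pair dist_real_def)
    done
  obtain K where K: "finite K" "K \<subseteq> sphere 0 1" "sphere 0 1 \<subseteq> (\<Union>x\<in>K. ball (x :: real^'n) d)"
  proof (rule compactE_image[OF compact_sphere, of "sphere 0 1" "\<lambda>x. ball x d" 0 1])
    show "sphere 0 1 \<subseteq> (\<Union>x\<in>sphere 0 1. ball (x :: real^'n) d)"
      using d(1) by (auto intro!: bexI)
  qed auto
  obtain p and N :: nat where p: "K = p ` {..<N}"
    using K(1) finite_imp_nat_seg_image_inj_on by (metis lessThan_def)
  \<comment> \<open>Making the balls disjoint yields a Borel partition of the sphere into pieces on
    which the kernel differs from its value at \<open>p k\<close> by less than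
    \<open>e'\<close>.\<close>
  define E where "E = (\<lambda>k. sphere 0 1 \<inter> disjointed (\<lambda>k. ball (p k) d) k)"
  have Em: "E k \<in> sets sphere_measure" for k
  proof -
    have "disjointed (\<lambda>k. ball (p k) d) k \<in> sets borel"
      unfolding disjointed_def by auto
    then show ?thesis
      by (auto simp: E_def sets_sphere_measure sets_restrict_space)
  qed
  have one: "(\<Sum>k<N. indicator (E k) w) = (1::real)" if w1: "norm w = 1" for w
  proof -
    have "w \<in> (\<Union>x\<in>K. ball x d)" using K(3) that by (auto simp del: mem_ball)
    then have "w \<in> (\<Union>k<N. ball (p k) d)" unfolding p by blast
    then have "w \<in> (\<Union>k<N. disjointed (\<lambda>k. ball (p k) d) k)"
      using finite_UN_disjointed_eq[of "\<lambda>k. ball (p k) d" N] by (simp add: atLeast0LessThan)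
    then obtain k where k: "k < N" "w \<in> E k" using w1 unfolding E_def by auto
    have "indicator (E j) w = (if j = k then 1 else (0::real))" for j
      using k(2) disjoint_family_disjointed[of "\<lambda>k. ball (p k) d"]
      by (auto simp: E_def disjoint_family_on_def indicator_def)
    then show ?thesis using k(1) by simp
  qed
  have near: "dist w (p k) < d" if "w \<in> E k" for w k
    using that disjointed_subset[of "\<lambda>k. ball (p k) d" k] by (auto simp: E_def dist_commute)
  \<comment> \<open>With these weights the finite sum is the integral of \<open>g\<close> against
    the kernel frozen at \<open>p k\<close> on each piece.\<close>
  define c where "c = (\<lambda>k. LINT w|sphere_measure. indicator (E k) w * g w)"
  have p1: "norm (p k) = 1" if "k < N" for k using K(2) p that by auto
  show thesis
  proof (rule that[OF p1])
    fix x :: "real^'n" assume x: "x \<in> cball 0 \<rho>"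
    then have x1: "norm x < 1" using \<rho> by simp
    have ig: "integrable sphere_measure (\<lambda>w. indicator (E k) w * g w)" for k
      using integrable_mult_indicator[OF Em g] by simp
    let ?P = "\<lambda>w. poisson_kernel x w"
    have iPg: "integrable sphere_measure (\<lambda>w. ?P w * g w)"
      by (rule integrable_poisson_kernel_mult[OF x1 g])
    have isum: "integrable sphere_measure (\<lambda>w. \<Sum>k<N. indicator (E k) w * g w * ?P (p k))"
      using ig by (intro Bochner_Integration.integrable_sum integrable_mult_left) auto
    have "(\<Sum>k<N. c k * ?P (p k)) = (LINT w|sphere_measure. (\<Sum>k<N. indicator (E k) w * g w * ?P (p k)))"
      unfolding c_def using ig by (subst Bochner_Integration.integral_sum) auto
    then have "poisson_integral g x - (\<Sum>k<N. c k * ?P (p k)) =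
       (LINT w|sphere_measure. ?P w * g w - (\<Sum>k<N. indicator (E k) w * g w * ?P (p k)))"
      unfolding poisson_integral_kernel using iPg isum by simp
    moreover have "\<bar>\<dots>\<bar> \<le> (LINT w|sphere_measure. \<bar>?P w * g w - (\<Sum>k<N. indicator (E k) w * g w * ?P (p k))\<bar>)"
      by (rule integral_abs_bound)
    moreover have "\<dots> \<le> (LINT w|sphere_measure. e' * \<bar>g w\<bar>)"
    proof (rule integral_mono)
      fix w :: "real^'n" assume "w \<in> space sphere_measure"
      then have w: "norm w = 1" by (simp add: space_sphere_measure)
      have "?P w * g w - (\<Sum>k<N. indicator (E k) w * g w * ?P (p k)) =
         (\<Sum>k<N. indicator (E k) w) * (?P w * g w) - (\<Sum>k<N. indicator (E k) w * g w * ?P (p k))"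
        by (simp add: one[OF w])
      also have "\<dots> = (\<Sum>k<N. indicator (E k) w * ((?P w - ?P (p k)) * g w))"
        unfolding sum_distrib_right sum_subtractf[symmetric] by (intro sum.cong) (simp_all add: algebra_simps)
      also have "\<bar>\<dots>\<bar> \<le> (\<Sum>k<N. indicator (E k) w * (e' * \<bar>g w\<bar>))"
      proof (rule order_trans[OF sum_abs sum_mono])
        fix k assume k: "k \<in> {..<N}"
        show "\<bar>indicator (E k) w * ((?P w - ?P (p k)) * g w)\<bar> \<le> indicator (E k) w * (e' * \<bar>g w\<bar>)"
        proof (cases "w \<in> E k")
          case True
          then have "\<bar>?P w - ?P (p k)\<bar> < e'" using d(2)[OF x w p1 near] k by auto
          then show ?thesis using True by (auto simp: abs_mult intro!: mult_right_mono)
        qed simp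
      qed
      also have "\<dots> = e' * \<bar>g w\<bar>" by (simp add: sum_distrib_right[symmetric] one[OF w])
      finally show "\<bar>?P w * g w - (\<Sum>k<N. indicator (E k) w * g w * ?P (p k))\<bar> \<le> e' * \<bar>g w\<bar>" .
    qed (use iPg isum g in auto)
    moreover have "\<dots> = e' * G" by (simp add: G_def)
    ultimately show "\<bar>poisson_integral g x - (\<Sum>k<N. c k * ?P (p k))\<bar> \<le> e" using e'G by linarith
  qed
qed

text \<open>A finite sum of kernels has its poles on the unit sphere, hence is harmonic on the
  smaller ball, and \<open>maximum_principle\<close> applies to it minus \<open>f\<close>. The
  approximation costs \<open>e / 2\<close> on the sphere and again at \<open>x\<close>.\<close>

lemma poisson_integral_maximum_principle:
  fixes f g :: "real^'n::finite \<Rightarrow> real"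
  assumes g: "integrable sphere_measure g" and \<rho>: "\<rho> < 1"
    and cont: "continuous_on (cball 0 \<rho>) f"
    and lap: "\<And>x. x \<in> ball 0 \<rho> \<Longrightarrow> has_laplacian f 0 x"
    and bd: "\<And>x. x \<in> sphere 0 \<rho> \<Longrightarrow> poisson_integral g x - f x \<le> M" and x: "x \<in> cball 0 \<rho>"
  shows "poisson_integral g x - f x \<le> M"
proof (rule field_le_epsilon)
  fix e :: real assume "e > 0"
  then have "e / 2 > 0" by simp
  from poisson_integral_sum_approx[OF g \<rho> this] obtain N :: nat and c and p :: "nat \<Rightarrow> real^'n"
    where p: "\<And>k. k < N \<Longrightarrow> norm (p k) = 1" and
    ap: "\<And>x. x \<in> cball 0 \<rho> \<Longrightarrow> \<bar>poisson_integral g x - (\<Sum>k<N. c k * poisson_kernel x (p k))\<bar> \<le> e / 2"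
    by metis
  let ?h = "\<lambda>x. (\<Sum>k<N. c k * poisson_kernel x (p k)) - f x"
  have ne: "x \<noteq> p k" if "x \<in> cball 0 \<rho>" "k < N" for x k using p[OF that(2)] that(1) \<rho> by auto
  have "?h x \<le> M + e / 2"
  proof (rule maximum_principle[OF _ _ _ x])
    show "continuous_on (cball 0 \<rho>) ?h"
      unfolding poisson_kernel_def by (intro continuous_intros cont) (use ne in auto)
    show "has_laplacian ?h 0 y" if y: "y \<in> ball 0 \<rho>" for y
    proof -
      have "has_laplacian (\<lambda>x. c k * poisson_kernel x (p k)) 0 y" if "k < N" for k
        using has_laplacian_cmult[OF has_laplacian_poisson_kernel[OF p[OF that] ne[OF _ that]], of y "c k"] y by auto
      then show ?thesis
        using has_laplacian_diff[OF has_laplacian_sum lap[OF y], of "{..<N}"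
            "\<lambda>k x. c k * poisson_kernel x (p k)"] by simp
    qed
    show "?h y \<le> M + e / 2" if y: "y \<in> sphere 0 \<rho>" for y
    proof -
      have "y \<in> cball 0 \<rho>" using y by simp
      from ap[OF this] show ?thesis using bd[OF y] unfolding abs_le_iff by linarith
    qed
  qed
  then show "poisson_integral g x - f x \<le> M + e" using ap[OF x] by (simp add: abs_le_iff) argo
qed

text \<open>The one-sided version serves for \<open>g\<close>, \<open>f\<close> and for their
  negatives.\<close>

lemma poisson_integral_maximum_principle_abs:
  fixes f g :: "real^'n::finite \<Rightarrow> real"
  assumes g: "integrable sphere_measure g" and \<rho>: "\<rho> < 1"
    and cont: "continuous_on (cball 0 \<rho>) f"
    and lap: "\<And>x. x \<in> ball 0 \<rho> \<Longrightarrow> has_laplacian f 0 x"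
    and bd: "\<And>x. x \<in> sphere 0 \<rho> \<Longrightarrow> \<bar>poisson_integral g x - f x\<bar> \<le> M" and x: "x \<in> cball 0 \<rho>"
  shows "\<bar>poisson_integral g x - f x\<bar> \<le> M"
proof -
  have "poisson_integral g x - f x \<le> M"
    by (rule poisson_integral_maximum_principle[OF g \<rho> cont lap _ x]) (use bd in \<open>auto simp: abs_le_iff\<close>)
  moreover have "poisson_integral (\<lambda>w. - g w) x - (- f x) \<le> M"
    by (rule poisson_integral_maximum_principle[OF _ \<rho> _ _ _ x])
      (use g cont has_laplacian_cmult[OF lap, of _ "-1"] bd in \<open>auto simp: abs_le_iff poisson_integral_uminus intro!: continuous_intros\<close>)
  ultimately show ?thesis by (simp add: poisson_integral_uminus abs_le_iff)
qed

section \<open>The Poisson formula for functions continuous on the closed ball\<close>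

lemma poisson_integral_one:
  fixes x :: "real^'n::{finite,wellorder}"
  assumes x: "norm x < 1"
  shows "poisson_integral (\<lambda>w. 1) x = 1"
proof -
  let ?one = "\<lambda>w :: real^'n::_. 1 :: real"
  \<comment> \<open>By rotation invariance the integral is constant on the sphere through
    \<open>x\<close>. The maximum principle, with that constant as \<open>f\<close>, carries the
    value to the centre, where the kernel is 1.\<close>
  have radial: "poisson_integral ?one y = poisson_integral ?one x" if y: "norm y = norm x" for y
  proof -
    obtain T where T: "orthogonal_transformation T" "T x = y"
      using orthogonal_transformation_exists[OF y[symmetric]] by blast
    show ?thesis using poisson_integral_orthogonal[OF T(1) _ x, of ?one] T(2) by simp
  qed
  have "\<bar>poisson_integral ?one 0 - poisson_integral ?one x\<bar> \<le> 0"
  proof (rule poisson_integral_maximum_principle_abs[OF _ x, where f = "\<lambda>y. poisson_integral ?one x"])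
    show "\<bar>poisson_integral ?one y - poisson_integral ?one x\<bar> \<le> 0" if "y \<in> sphere 0 (norm x)" for y
      using radial[of y] that by simp
  qed (simp_all add: has_laplacian_const)
  moreover have "poisson_integral ?one 0 = (LINT w|(sphere_measure :: (real^'n::_) measure). 1)"
    unfolding poisson_integral_kernel
    by (rule Bochner_Integration.integral_cong) (auto simp: poisson_kernel_def space_sphere_measure)
  moreover have "\<dots> = 1"
    by (simp add: space_sphere_measure measure_def emeasure_sphere_measure_sphere)
  ultimately show ?thesis by simp
qed

text \<open>For \<open>y\<close> close to the sphere, boundary points within \<open>d\<close> of
  \<open>y\<close> contribute little to the difference since \<open>u\<close> varies little there,
  the others since the kernel is small. So both sides nearly agree on a sphere of radius
  \<open>r\<close>, hence also at \<open>x\<close>.\<close>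

lemma poisson_formula:
  fixes u :: "real^'n::{finite,wellorder} \<Rightarrow> real"
  assumes cont: "continuous_on (cball 0 1) u"
    and lap: "\<And>x. x \<in> ball 0 1 \<Longrightarrow> has_laplacian u 0 x" and x: "norm x < 1"
  shows "poisson_integral u x = u x"
proof -
  obtain M where M: "\<And>y. y \<in> cball 0 1 \<Longrightarrow> \<bar>u y\<bar> \<le> M"
    using compact_imp_bounded[OF compact_continuous_image[OF cont compact_cball]]
    unfolding bounded_iff by (metis imageI real_norm_def)
  have um: "u \<in> borel_measurable sphere_measure"
    by (intro borel_measurable_sphere_measureI continuous_on_subset[OF cont]) auto
  have ui: "integrable sphere_measure u"
    by (rule integrable_sphere_measureI[OF um, of M]) (use M in auto)
  have "\<bar>poisson_integral u x - u x\<bar> \<le> 0 + e" if e: "e > 0" for e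
  proof -
    have "uniformly_continuous_on (cball 0 1) u"
      by (rule compact_uniformly_continuous[OF cont compact_cball])
    then have "\<forall>e>0. \<exists>d>0. \<forall>y\<in>cball 0 1. \<forall>z\<in>cball 0 1. dist z y < d \<longrightarrow> dist (u z) (u y) < e"
      by (simp only: uniformly_continuous_on_def)
    from this[rule_format, OF half_gt_zero[OF e]]
    obtain d where d: "d > 0" "\<And>y z. y \<in> cball 0 1 \<Longrightarrow> z \<in> cball 0 1 \<Longrightarrow> dist y z < d \<Longrightarrow> \<bar>u y - u z\<bar> < e / 2"
      unfolding dist_real_def by blast
    \<comment> \<open>\<open>2 * M\<close> bounds the oscillation of \<open>u\<close>, so this
      bounds the contribution of the distant points. It vanishes as \<open>r\<close> tends to
      1.\<close>
    have "((\<lambda>r. (1 - r\<^sup>2) / d ^ CARD('n) * (2 * M)) \<longlongrightarrow> (1 - 1\<^sup>2) / d ^ CARD('n) * (2 * M)) (at_left 1)"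
      using d(1) by (intro tendsto_intros) auto
    then have "\<forall>\<^sub>F r in at_left 1. (1 - r\<^sup>2) / d ^ CARD('n) * (2 * M) < e / 2"
      using e by (intro order_tendstoD) auto
    moreover have "\<forall>\<^sub>F r in at_left (1::real). r \<in> {norm x<..<1}"
      by (rule eventually_at_left_real[OF x])
    ultimately have "\<forall>\<^sub>F r in at_left 1. (1 - r\<^sup>2) / d ^ CARD('n) * (2 * M) < e / 2 \<and> r < 1 \<and> norm x < r"
      by eventually_elim auto
    then have "\<exists>r. (1 - r\<^sup>2) / d ^ CARD('n) * (2 * M) < e / 2 \<and> r < 1 \<and> norm x < r"
      by (rule eventually_happens'[OF trivial_limit_at_left_real])
    then obtain r where r: "(1 - r\<^sup>2) / d ^ CARD('n) * (2 * M) < e / 2" "r < 1" "norm x < r"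
      by blast
    have "\<bar>poisson_integral u x - u x\<bar> \<le> e"
    proof (rule poisson_integral_maximum_principle_abs[OF ui r(2)])
      show "continuous_on (cball 0 r) u" using r by (intro continuous_on_subset[OF cont]) auto
      show "has_laplacian u 0 y" if "y \<in> ball 0 r" for y using that r by (intro lap) auto
      show "x \<in> cball 0 r" using r by auto
      fix y :: "real^'n::_" assume "y \<in> sphere 0 r"
      then have y: "norm y = r" "norm y < 1" "y \<in> cball 0 1" using r by auto
      let ?P = "poisson_kernel y"
      have i1: "integrable sphere_measure (\<lambda>w. ?P w * u w)" "integrable sphere_measure (\<lambda>w. ?P w * 1)"
        by (rule integrable_poisson_kernel_mult[OF y(2)]; simp add: ui)+
      then have i2: "integrable sphere_measure ?P" by simp
      have one: "(LINT w|sphere_measure. ?P w) = 1"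
        using poisson_integral_one[OF y(2)] by (simp add: poisson_integral_kernel)
      have "poisson_integral u y - u y = (LINT w|sphere_measure. ?P w * u w) - (LINT w|sphere_measure. ?P w * u y)"
        by (simp add: poisson_integral_kernel one)
      also have "\<dots> = (LINT w|sphere_measure. ?P w * u w - ?P w * u y)"
        by (rule Bochner_Integration.integral_diff[symmetric, OF i1(1)]) (simp add: i2)
      also have "\<bar>\<dots>\<bar> \<le> (LINT w|sphere_measure. \<bar>?P w * u w - ?P w * u y\<bar>)"
        by (rule integral_abs_bound)
      \<comment> \<open>The first summand covers the points near \<open>y\<close>, the second the
        distant ones. The integral is \<open>e\<close> because the kernel integrates to 1 and the
        sphere has measure 1.\<close>
      also have "\<dots> \<le> (LINT w|sphere_measure. ?P w * (e / 2) + e / 2)"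
      proof (rule integral_mono)
        fix w :: "real^'n::_" assume "w \<in> space sphere_measure"
        then have w: "norm w = 1" "w \<in> cball 0 1" by (auto simp: space_sphere_measure)
        have P0: "?P w \<ge> 0" by (rule poisson_kernel_nonneg[OF y(2)])
        have "\<bar>?P w * u w - ?P w * u y\<bar> = ?P w * \<bar>u w - u y\<bar>"
          using P0 by (simp add: right_diff_distrib[symmetric] abs_mult)
        also have "\<dots> \<le> ?P w * (e / 2) + e / 2"
        proof (cases "dist w y < d")
          case True
          then have "?P w * \<bar>u w - u y\<bar> \<le> ?P w * (e / 2)"
            using d(2)[OF w(2) y(3)] P0 by (intro mult_left_mono) auto
          then show ?thesis using e by simp
        next
          case False
          then have "?P w \<le> (1 - r\<^sup>2) / d ^ CARD('n)"
            using poisson_kernel_le[OF y(2) d(1), of w] y(1) by (simp add: dist_norm norm_minus_commute)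
          moreover have "\<bar>u w - u y\<bar> \<le> 2 * M" using M[OF w(2)] M[OF y(3)] by linarith
          ultimately have "?P w * \<bar>u w - u y\<bar> \<le> (1 - r\<^sup>2) / d ^ CARD('n) * (2 * M)"
            using P0 by (intro mult_mono) auto
          moreover have "0 \<le> ?P w * (e / 2)" using P0 e by simp
          ultimately show ?thesis using r(1) by linarith
        qed
        finally show "\<bar>?P w * u w - ?P w * u y\<bar> \<le> ?P w * (e / 2) + e / 2" .
      qed (use i1 i2 in auto)
      also have "\<dots> = e"
        using i2 by (simp add: one space_sphere_measure measure_def emeasure_sphere_measure_sphere)
      finally show "\<bar>poisson_integral u y - u y\<bar> \<le> e" .
    qed
    then show ?thesis by simp
  qed
  then have "\<bar>poisson_integral u x - u x\<bar> \<le> 0" by (rule field_le_epsilon)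
  then show ?thesis by simp
qed

subsection \<open>The extremal function\<close>

text \<open>The cone over this equator lies in a hyperplane, a Lebesgue null set.\<close>

lemma AE_sphere_inner_nonzero:
  fixes a :: "real^'n::finite"
  assumes "a \<noteq> 0"
  shows "AE w in sphere_measure. inner a w \<noteq> 0"
proof (rule AE_I')
  let ?E = "{w \<in> sphere 0 1. inner a w = 0}"
  let ?H = "{w. inner a w = 0}"
  have H: "closed ?H" by (rule closed_hyperplane)
  have E: "?E \<in> sets sphere_measure"
  proof -
    have "?E = sphere 0 1 \<inter> ?H" by auto
    then show ?thesis using H
      by (auto simp: sets_sphere_measure sets_restrict_space)
  qed
  have "?H \<in> null_sets lebesgue"
    using negligible_hyperplane[of a 0] assms by (simp add: negligible_iff_null_sets)
  then have "emeasure lborel ?H = 0"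
    using H by (auto simp: null_sets_def)
  moreover have "{r *\<^sub>R \<omega> |r \<omega>. 0 < r \<and> r < 1 \<and> \<omega> \<in> ?E} \<subseteq> ?H" by auto
  moreover have "?H \<in> sets lborel" using H by simp
  ultimately have "emeasure lborel {r *\<^sub>R \<omega> |r \<omega>. 0 < r \<and> r < 1 \<and> \<omega> \<in> ?E} = 0"
    by (metis (lifting) emeasure_mono le_zero_eq)
  then have "emeasure sphere_measure ?E = 0"
    by (subst emeasure_sphere_measure[OF E]) simp
  then show "?E \<in> null_sets sphere_measure" using E by (simp add: null_sets_def)
qed (auto simp: space_sphere_measure)

lemma sgn_inner_measurable_sphere:
  fixes a :: "real^'n::finite"
  shows "(\<lambda>w. sgn (inner a w)) \<in> borel_measurable sphere_measure"
proof (rule measurable_compose[OF _ borel_measurable_sgn])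
  show "inner a \<in> borel_measurable sphere_measure"
    by (intro borel_measurable_sphere_measureI continuous_intros)
qed

lemma abs_sgn_real_le: "\<bar>sgn t\<bar> \<le> (1::real)"
  by (simp add: sgn_if)

lemma integrable_sgn_inner_sphere:
  fixes a :: "real^'n::finite"
  shows "integrable sphere_measure (\<lambda>w. sgn (inner a w))"
  by (rule integrable_sphere_measureI[OF sgn_inner_measurable_sphere, where B = 1]) (rule abs_sgn_real_le)

text \<open>The integrand is odd and the measure is invariant under the antipodal map.\<close>

lemma integral_sgn_inner_sphere:
  fixes a :: "real^'n::{finite,wellorder}"
  shows "(LINT w|sphere_measure. sgn (inner a w)) = 0"
proof -
  have "orthogonal_transformation (uminus :: real^'n::_ \<Rightarrow> _)"
    by (simp add: orthogonal_transformation_def linear_uminus)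
  from integral_sphere_orthogonal[OF this sgn_inner_measurable_sphere, of a]
  show ?thesis by (simp add: sgn_minus)
qed

text \<open>On the sphere the boundary function is the sign of the last coordinate, equator
  included. As the sign of an inner product it is easily rotated.\<close>

lemma hemisphere_poisson_eq:
  fixes x :: "real^'n::{finite,wellorder}"
  shows "hemisphere_poisson x = poisson_integral (\<lambda>w. sgn (inner north_pole w)) x"
  unfolding hemisphere_poisson_def poisson_integral_kernel
  by (rule Bochner_Integration.integral_cong)
    (auto simp: space_sphere_measure upper_hemisphere_def lower_hemisphere_def north_pole_def inner_axis' sgn_if)

text \<open>Row multiplication by \<open>A\<close> is orthogonal and takes \<open>a\<close> to a
  positive multiple of the pole, so \<open>w\<close> lies on the side of \<open>a\<close> exactly if
  \<open>w v* A\<close> lies on the side of the pole.\<close>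

lemma hemisphere_poisson_rotated:
  fixes A :: "real^'n::{finite,wellorder}^'n::_"
  assumes A: "orthogonal_matrix A" and a: "a v* A = norm a *\<^sub>R north_pole" "a \<noteq> 0" and x: "norm x < 1"
  shows "hemisphere_poisson (x v* A) = poisson_integral (\<lambda>w. sgn (inner a w)) x"
proof -
  define T where "T = (\<lambda>x. x v* A)"
  have "T = (*v) (transpose A)" by (auto simp: T_def)
  then have T: "orthogonal_transformation T"
    using A by (simp add: orthogonal_transformation_matrix orthogonal_matrix_transpose)
  have "inner a w = norm a * inner north_pole (T w)" for w
    using T a(1) unfolding orthogonal_transformation_def T_def by (metis inner_scaleR_left)
  then have s: "sgn (inner a w) = sgn (inner north_pole (T w))" for w
    using a(2) by (simp add: sgn_mult)
  have "hemisphere_poisson (T x) = poisson_integral (\<lambda>w. sgn (inner north_pole (T w))) x"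
    unfolding hemisphere_poisson_eq
    by (rule poisson_integral_orthogonal[OF T sgn_inner_measurable_sphere x])
  then show ?thesis by (simp add: s T_def)
qed

text \<open>Orthogonal maps act transitively on spheres about 0. The transpose appears because
  matrices act on the right.\<close>

lemma orthogonal_matrix_to_north_pole:
  fixes a :: "real^'n::{finite,wellorder}"
  obtains A :: "real^'n::_^'n::_" where "orthogonal_matrix A" "a v* A = norm a *\<^sub>R north_pole"
proof -
  define b where "b = norm a *\<^sub>R (north_pole :: real^'n::_)"
  have "norm a = norm b" by (simp add: b_def north_pole_def)
  then obtain T where T: "orthogonal_transformation T" "T a = b"
    using orthogonal_transformation_exists[of a b] by blast
  have "orthogonal_matrix (transpose (matrix T))"
    using T(1) by (simp add: orthogonal_transformation_matrix orthogonal_matrix_transpose)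
  moreover have "a v* transpose (matrix T) = b"
    using T matrix_works[of T a] by (simp add: orthogonal_transformation_linear)
  ultimately show thesis using that b_def by blast
qed

section \<open>Comparison of the kernel with its value on the equator\<close>

definition equator_value :: "real^'n::finite \<Rightarrow> real"
  where "equator_value x = (1 - (norm x)\<^sup>2) / sqrt (1 + (norm x)\<^sup>2) ^ CARD('n)"

text \<open>The square of \<open>norm (x - w)\<close> is
  \<open>1 + (norm x)\<^sup>2 - 2 * inner x w\<close>, so the kernel increases strictly with
  \<open>inner x w\<close> and takes the value \<open>equator_value x\<close> where this is
  0.\<close>

lemma sgn_poisson_kernel_minus_equator_value:
  fixes x w :: "real^'n::finite"
  assumes x: "norm x < 1" and w: "norm w = 1"
  shows "sgn (poisson_kernel x w - equator_value x) = sgn (inner x w)"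
proof -
  have q: "norm (x - w) = sqrt (1 + (norm x)\<^sup>2 - 2 * inner x w)"
    using w unfolding norm_eq_sqrt_inner by (simp add: inner_simps inner_commute)
  have pos: "norm (x - w) > 0" using x w by auto
  have num: "1 - (norm x)\<^sup>2 > 0" using x by (simp add: abs_square_less_1)
  have s: "sqrt (1 + (norm x)\<^sup>2) > 0" by (simp add: add_pos_nonneg)
  consider "inner x w > 0" | "inner x w = 0" | "inner x w < 0" by linarith
  then show ?thesis
  proof cases
    case 1
    then have "norm (x - w) < sqrt (1 + (norm x)\<^sup>2)"
      unfolding q by (intro real_sqrt_less_mono) simp
    then have "norm (x - w) ^ CARD('n) < sqrt (1 + (norm x)\<^sup>2) ^ CARD('n)"
      by (intro power_strict_mono) auto
    then have "equator_value x < poisson_kernel x w"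
      unfolding equator_value_def poisson_kernel_def
      using num pos s by (intro divide_strict_left_mono) auto
    then show ?thesis using 1 by simp
  next
    case 2
    then show ?thesis by (simp add: equator_value_def poisson_kernel_def q)
  next
    case 3
    then have "sqrt (1 + (norm x)\<^sup>2) ^ CARD('n) < norm (x - w) ^ CARD('n)"
      using s by (intro power_strict_mono) (auto simp: q)
    then have "poisson_kernel x w < equator_value x"
      unfolding equator_value_def poisson_kernel_def
      using num pos s by (intro divide_strict_left_mono) auto
    then show ?thesis using 3 by simp
  qed
qed

text \<open>Subtracting the constant from the kernel changes nothing, as the sign and
  \<open>g\<close> both have mean zero. The shifted kernel times
  \<open>sgn (inner x w) - g w\<close> is nonnegative, since \<open>\<bar>g w\<bar> \<le> 1\<close>,
  so it equals its absolute value \<open>h\<close>.\<close>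

lemma bathtub_identity:
  fixes x :: "real^'n::{finite,wellorder}"
  assumes x: "norm x < 1" and g: "g \<in> borel_measurable sphere_measure" "\<And>w. norm w = 1 \<Longrightarrow> \<bar>g w\<bar> \<le> 1"
    and g0: "(LINT w|sphere_measure. g w) = 0"
  defines "h \<equiv> \<lambda>w. \<bar>poisson_kernel x w - equator_value x\<bar> * \<bar>sgn (inner x w) - g w\<bar>"
  shows "integrable sphere_measure h"
    and "poisson_integral (\<lambda>w. sgn (inner x w)) x - poisson_integral g x = (LINT w|sphere_measure. h w)"
proof -
  let ?P = "poisson_kernel x" and ?c = "equator_value x" and ?s = "\<lambda>w. sgn (inner x w)"
  have gi: "integrable sphere_measure g" by (rule integrable_sphere_measureI[OF g])
  have si: "integrable sphere_measure ?s" by (rule integrable_sgn_inner_sphere)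
  have Pg: "integrable sphere_measure (\<lambda>w. ?P w * g w)" and Ps: "integrable sphere_measure (\<lambda>w. ?P w * ?s w)"
    by (rule integrable_poisson_kernel_mult[OF x]; fact)+
  have eq: "h w = (?P w * ?s w - ?P w * g w) - (?c * ?s w - ?c * g w)" if "w \<in> space sphere_measure" for w
  proof -
    have w: "norm w = 1" using that by (simp add: space_sphere_measure)
    have "h w = (?P w - ?c) * (?s w - g w)"
    proof -
      have "?s w = 1 \<and> ?P w - ?c > 0 \<or> ?s w = 0 \<and> ?P w - ?c = 0 \<or> ?s w = - 1 \<and> ?P w - ?c < 0"
        using sgn_poisson_kernel_minus_equator_value[OF x w] by (auto simp: sgn_if split: if_splits)
      then have "0 \<le> (?P w - ?c) * (?s w - g w)"
        using g(2)[OF w] by (elim disjE conjE) (auto intro!: mult_nonneg_nonneg mult_nonpos_nonpos)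
      then show ?thesis by (simp add: h_def abs_mult[symmetric])
    qed
    then show ?thesis by (simp add: algebra_simps)
  qed
  have i: "integrable sphere_measure (\<lambda>w. (?P w * ?s w - ?P w * g w) - (?c * ?s w - ?c * g w))"
    using gi si Pg Ps by (intro Bochner_Integration.integrable_diff integrable_mult_right) auto
  then show "integrable sphere_measure h"
    by (subst Bochner_Integration.integrable_cong[OF refl eq])
  have "(LINT w|sphere_measure. h w) = (LINT w|sphere_measure. (?P w * ?s w - ?P w * g w) - (?c * ?s w - ?c * g w))"
    by (rule Bochner_Integration.integral_cong[OF refl eq])
  also have "\<dots> = poisson_integral ?s x - poisson_integral g x"
    using gi si Pg Ps by (simp add: g0 integral_sgn_inner_sphere poisson_integral_kernel)
  finally show "poisson_integral ?s x - poisson_integral g x = (LINT w|sphere_measure. h w)" by simp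
qed

section \<open>Dilations of functions on the open ball\<close>

lemma poisson_formula_dilated:
  fixes u :: "real^'n::{finite,wellorder} \<Rightarrow> real"
  assumes cont: "continuous_on (ball 0 1) u"
    and lap: "\<And>x. x \<in> ball 0 1 \<Longrightarrow> has_laplacian u 0 x"
    and r: "0 \<le> r" "r < 1" and x: "norm x < 1"
  shows "poisson_integral (\<lambda>w. u (r *\<^sub>R w)) x = u (r *\<^sub>R x)"
    and "(\<lambda>w. u (r *\<^sub>R w)) \<in> borel_measurable sphere_measure"
proof -
  have sub: "r *\<^sub>R y \<in> ball 0 1" if "norm y \<le> 1" for y :: "real^'n::_"
  proof -
    have "r * norm y \<le> r * 1" using r(1) that by (rule mult_left_mono[rotated])
    then show ?thesis using r by simp
  qed
  have c: "continuous_on (cball 0 1) (\<lambda>w. u (r *\<^sub>R w))"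
    by (intro continuous_on_compose2[OF cont] continuous_intros) (use sub in auto)
  show "poisson_integral (\<lambda>w. u (r *\<^sub>R w)) x = u (r *\<^sub>R x)"
  proof (rule poisson_formula[OF c _ x])
    fix y :: "real^'n::_" assume "y \<in> ball 0 1"
    then have "r *\<^sub>R y \<in> ball 0 1" by (intro sub) auto
    from has_laplacian_scaled[OF lap[OF this]] show "has_laplacian (\<lambda>w. u (r *\<^sub>R w)) 0 y" by simp
  qed
  show "(\<lambda>w. u (r *\<^sub>R w)) \<in> borel_measurable sphere_measure"
    by (intro borel_measurable_sphere_measureI continuous_on_subset[OF c]) auto
qed

text \<open>The mean value property: at the centre the kernel is 1.\<close>

lemma integral_dilated_eq_0:
  fixes u :: "real^'n::{finite,wellorder} \<Rightarrow> real"
  assumes "continuous_on (ball 0 1) u" "\<And>x. x \<in> ball 0 1 \<Longrightarrow> has_laplacian u 0 x"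
    and "0 \<le> r" "r < 1" and "u 0 = 0"
  shows "(LINT w|sphere_measure. u (r *\<^sub>R w)) = 0"
proof -
  have "(LINT w|sphere_measure. u (r *\<^sub>R w)) = poisson_integral (\<lambda>w. u (r *\<^sub>R w)) 0"
    unfolding poisson_integral_kernel
    by (rule Bochner_Integration.integral_cong) (auto simp: poisson_kernel_def space_sphere_measure)
  then show ?thesis using poisson_formula_dilated(1)[OF assms(1-4), of 0] assms(5) by simp
qed

lemma tendsto_dilated:
  fixes u :: "real^'n::finite \<Rightarrow> real"
  assumes "continuous_on (ball 0 1) u" "norm x < 1" "\<rho> \<longlonglongrightarrow> 1"
  shows "(\<lambda>k. u (\<rho> k *\<^sub>R x)) \<longlonglongrightarrow> u x"
proof -
  have "isCont u x" using assms continuous_on_eq_continuous_at[of "ball 0 1" u] by simp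
  moreover have "(\<lambda>k. \<rho> k *\<^sub>R x) \<longlonglongrightarrow> 1 *\<^sub>R x" by (intro tendsto_intros assms)
  ultimately show ?thesis using isCont_tendsto_compose[of x u "\<lambda>k. \<rho> k *\<^sub>R x"] by simp
qed

subsection \<open>Schwarz lemma\<close>

text \<open>For the dilations, \<open>bathtub_identity\<close> gives the defect as the integral of a
  nonnegative function. In the equality case these functions tend to 0 in mean, hence almost
  everywhere along a subsequence; the kernel factor, nonzero off the equator, is then divided
  out.\<close>

lemma harmonic_schwarz:
  fixes u :: "real^'n::{finite,wellorder} \<Rightarrow> real"
  assumes cont: "continuous_on (ball 0 1) u"
    and lap: "\<And>x. x \<in> ball 0 1 \<Longrightarrow> has_laplacian u 0 x"
    and bd: "\<And>x. x \<in> ball 0 1 \<Longrightarrow> \<bar>u x\<bar> \<le> 1" and u0: "u 0 = 0" and x: "norm x < 1"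
    and \<rho>: "\<And>k. 0 \<le> \<rho> k" "\<And>k. \<rho> k < 1" "\<rho> \<longlonglongrightarrow> (1::real)"
  shows "u x \<le> poisson_integral (\<lambda>w. sgn (inner x w)) x"
    and "x \<noteq> 0 \<Longrightarrow> u x = poisson_integral (\<lambda>w. sgn (inner x w)) x \<Longrightarrow>
      \<exists>\<phi>::nat \<Rightarrow> nat. strict_mono \<phi> \<and> (AE w in sphere_measure. (\<lambda>k. u (\<rho> (\<phi> k) *\<^sub>R w)) \<longlonglongrightarrow> sgn (inner x w))"
proof -
  let ?S = "poisson_integral (\<lambda>w. sgn (inner x w)) x"
  define h where "h = (\<lambda>k w. \<bar>poisson_kernel x w - equator_value x\<bar> * \<bar>sgn (inner x w) - u (\<rho> k *\<^sub>R w)\<bar>)"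
  have bdr: "\<bar>u (\<rho> k *\<^sub>R w)\<bar> \<le> 1" if "norm w = 1" for k w
    using that \<rho>(1,2)[of k] by (intro bd) auto
  have rep: "poisson_integral (\<lambda>w. u (\<rho> k *\<^sub>R w)) x = u (\<rho> k *\<^sub>R x)" for k
    by (rule poisson_formula_dilated(1)[OF cont lap \<rho>(1,2) x])
  have hi: "integrable sphere_measure (h k)"
    and heq: "?S - u (\<rho> k *\<^sub>R x) = (LINT w|sphere_measure. h k w)" for k
    using bathtub_identity[OF x poisson_formula_dilated(2)[OF cont lap \<rho>(1,2) x, of k] bdr
        integral_dilated_eq_0[OF cont lap \<rho>(1,2) u0, of k]]
    unfolding h_def rep by simp_all
  have lim: "(\<lambda>k. u (\<rho> k *\<^sub>R x)) \<longlonglongrightarrow> u x" by (rule tendsto_dilated[OF cont x \<rho>(3)])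
  have "u (\<rho> k *\<^sub>R x) \<le> ?S" for k
  proof -
    have "0 \<le> (LINT w|sphere_measure. h k w)" by (rule Bochner_Integration.integral_nonneg) (simp add: h_def)
    then show ?thesis using heq[of k] by linarith
  qed
  then show "u x \<le> ?S" by (intro LIMSEQ_le_const2[OF lim]) auto
  assume x0: "x \<noteq> 0" and eq: "u x = ?S"
  have "(\<lambda>k. ?S - u (\<rho> k *\<^sub>R x)) \<longlonglongrightarrow> ?S - u x" by (intro tendsto_intros lim)
  then have "(\<lambda>k. LINT w|sphere_measure. norm (h k w)) \<longlonglongrightarrow> 0"
    by (simp add: eq heq h_def)
  from tendsto_L1_AE_subseq[OF hi this] obtain \<phi> :: "nat \<Rightarrow> nat" where \<phi>: "strict_mono \<phi>"
    "AE w in sphere_measure. (\<lambda>k. h (\<phi> k) w) \<longlonglongrightarrow> 0" by blast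
  have "AE w in sphere_measure. (\<lambda>k. u (\<rho> (\<phi> k) *\<^sub>R w)) \<longlonglongrightarrow> sgn (inner x w)"
    using \<phi>(2) AE_sphere_inner_nonzero[OF x0] AE_space
  proof eventually_elim
    case (elim w)
    let ?d = "\<bar>poisson_kernel x w - equator_value x\<bar>"
    have "norm w = 1" using elim by (simp add: space_sphere_measure)
    then have "?d \<noteq> 0"
      using sgn_poisson_kernel_minus_equator_value[OF x, of w] elim(2) by (auto simp: sgn_0_0)
    have "(\<lambda>k. h (\<phi> k) w / ?d) \<longlonglongrightarrow> 0 / ?d" by (rule tendsto_divide[OF elim(1) tendsto_const \<open>?d \<noteq> 0\<close>])
    then have "(\<lambda>k. \<bar>sgn (inner x w) - u (\<rho> (\<phi> k) *\<^sub>R w)\<bar>) \<longlonglongrightarrow> 0"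
      using \<open>?d \<noteq> 0\<close> by (simp add: h_def)
    then have "(\<lambda>k. sgn (inner x w) - u (\<rho> (\<phi> k) *\<^sub>R w)) \<longlonglongrightarrow> 0"
      by (rule tendsto_rabs_zero_cancel)
    then have "(\<lambda>k. sgn (inner x w) - (sgn (inner x w) - u (\<rho> (\<phi> k) *\<^sub>R w))) \<longlonglongrightarrow> sgn (inner x w) - 0"
      by (intro tendsto_diff tendsto_const)
    then show ?case by simp
  qed
  then show "\<exists>\<phi>::nat \<Rightarrow> nat. strict_mono \<phi> \<and> (AE w in sphere_measure. (\<lambda>k. u (\<rho> (\<phi> k) *\<^sub>R w)) \<longlonglongrightarrow> sgn (inner x w))"
    using \<phi>(1) by blast
qed

section \<open>From harmonic functions to harmonic mappings\<close>

lemma continuous_on_harmonic_component: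
  assumes "harmonic_mapping_on S F"
  shows "continuous_on S (\<lambda>x. F x $ j)"
proof (rule continuous_at_imp_continuous_on, rule ballI, rule differentiable_imp_continuous_within)
  show "(\<lambda>x. F x $ j) differentiable (at x)" if "x \<in> S" for x
    using assms that by (simp add: harmonic_mapping_on_def C2_on_def)
qed

lemma harmonic_mapping_inner:
  fixes F :: "real^'n::finite \<Rightarrow> real^'k::finite"
  assumes F: "harmonic_mapping_on S F" and S: "open S"
  shows "continuous_on S (\<lambda>x. inner e (F x))"
    and "x \<in> S \<Longrightarrow> has_laplacian (\<lambda>x. inner e (F x)) 0 x"
proof -
  have "continuous_on S (\<lambda>x. \<Sum>j\<in>UNIV. e $ j * F x $ j)"
    by (intro continuous_on_sum continuous_on_mult continuous_on_const continuous_on_harmonic_component[OF F])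
  then show "continuous_on S (\<lambda>x. inner e (F x))" by (simp add: inner_vec_def)
  assume x: "x \<in> S"
  have "has_laplacian (\<lambda>x. \<Sum>j\<in>UNIV. e $ j * F x $ j) 0 x"
  proof (rule has_laplacian_sum)
    show "has_laplacian (\<lambda>x. e $ j * F x $ j) 0 x" for j
      using has_laplacian_cmult[OF has_laplacian_harmonic_component[OF F S x, of j], of "e $ j"] by simp
  qed simp
  then show "has_laplacian (\<lambda>x. inner e (F x)) 0 x" by (simp add: inner_vec_def)
qed

text \<open>Only the component along \<open>e\<close> is known to converge at the boundary, but
  \<open>norm (F y) \<le> 1\<close> forces the rest to vanish in the limit. Dominated convergence in
  the Poisson formulas of the dilated components then identifies \<open>F\<close>.\<close>

lemma harmonic_mapping_schwarz_equality:
  fixes F :: "real^'n::{finite,wellorder} \<Rightarrow> real^'k::finite"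
  assumes F: "harmonic_mapping_on (ball 0 1) F" and F1: "F ` ball 0 1 \<subseteq> ball 0 1" and F0: "F 0 = 0"
    and x0: "norm x0 < 1" "x0 \<noteq> 0" and e: "norm e = 1"
    and eq: "inner e (F x0) = poisson_integral (\<lambda>w. sgn (inner x0 w)) x0" and x: "norm x < 1"
  shows "F x = poisson_integral (\<lambda>w. sgn (inner x0 w)) x *\<^sub>R e"
proof -
  \<comment> \<open>Any radii in \<open>[0, 1)\<close> tending to 1 would do.\<close>
  define \<rho> where "\<rho> = (\<lambda>k. real k / real (Suc k))"
  have \<rho>: "\<And>k. 0 \<le> \<rho> k" "\<And>k. \<rho> k < 1" "\<rho> \<longlonglongrightarrow> 1"
    unfolding \<rho>_def using LIMSEQ_n_over_Suc_n by auto
  have nF: "norm (F y) \<le> 1" if "norm y < 1" for y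
    using F1 that by (force simp: image_subset_iff)
  have bd: "\<bar>inner e (F y)\<bar> \<le> 1" if "y \<in> ball 0 1" for y
    using Cauchy_Schwarz_ineq2[of e "F y"] e nF[of y] that by simp
  let ?s = "\<lambda>w. sgn (inner x0 w)"
  obtain \<phi> :: "nat \<Rightarrow> nat" where \<phi>: "strict_mono \<phi>"
    "AE w in sphere_measure. (\<lambda>k. inner e (F (\<rho> (\<phi> k) *\<^sub>R w))) \<longlonglongrightarrow> ?s w"
    using harmonic_schwarz(2)[OF harmonic_mapping_inner[OF F open_ball] bd _ x0(1) \<rho> x0(2) eq] F0 by auto
  define r where "r = \<rho> \<circ> \<phi>"
  have r: "\<And>k. 0 \<le> r k" "\<And>k. r k < 1" "r \<longlonglongrightarrow> 1"
    using \<rho>(1,2) LIMSEQ_subseq_LIMSEQ[OF \<rho>(3) \<phi>(1)] by (auto simp: r_def)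
  have nr: "norm (F (r k *\<^sub>R w)) \<le> 1" if "norm w = 1" for k w
    using that r(1,2)[of k] by (intro nF) simp
  have AE: "AE w in sphere_measure. (\<lambda>k. F (r k *\<^sub>R w)) \<longlonglongrightarrow> ?s w *\<^sub>R e"
    using \<phi>(2) AE_sphere_inner_nonzero[OF x0(2)] AE_space
  proof eventually_elim
    case (elim w)
    have w: "norm w = 1" using elim by (simp add: space_sphere_measure)
    have s2: "?s w * ?s w = 1" using elim(2) by (simp add: sgn_if)
    \<comment> \<open>Expand the square: \<open>F\<close> has norm at most 1, \<open>e\<close> has
      norm 1 and the sign squares to 1. The bound tends to 0 because the inner product tends to the
      sign.\<close>
    have le: "norm (F (r k *\<^sub>R w) - ?s w *\<^sub>R e) \<le> sqrt (2 - 2 * (?s w * inner e (F (r k *\<^sub>R w))))" for k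
    proof (rule real_le_rsqrt)
      have "(norm (F (r k *\<^sub>R w) - ?s w *\<^sub>R e))\<^sup>2 = (norm (F (r k *\<^sub>R w)))\<^sup>2 - 2 * (?s w * inner e (F (r k *\<^sub>R w)))
          + (?s w * ?s w) * (norm e)\<^sup>2"
        unfolding power2_norm_eq_inner by (simp add: inner_simps inner_commute)
      then show "(norm (F (r k *\<^sub>R w) - ?s w *\<^sub>R e))\<^sup>2 \<le> 2 - 2 * (?s w * inner e (F (r k *\<^sub>R w)))"
        using nr[OF w, of k] s2 e by (simp add: power_le_one)
    qed
    have "(\<lambda>k. sqrt (2 - 2 * (?s w * inner e (F (r k *\<^sub>R w))))) \<longlonglongrightarrow> sqrt (2 - 2 * (?s w * ?s w))"
      using elim(1) unfolding r_def comp_def by (intro tendsto_intros)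
    then have "(\<lambda>k. sqrt (2 - 2 * (?s w * inner e (F (r k *\<^sub>R w))))) \<longlonglongrightarrow> 0"
      unfolding s2 by simp
    then have "(\<lambda>k. F (r k *\<^sub>R w) - ?s w *\<^sub>R e) \<longlonglongrightarrow> 0"
      by (rule Lim_null_comparison[OF always_eventually, rotated]) (use le in blast)
    then show ?case by (simp add: LIM_zero_iff)
  qed
  show ?thesis
  proof (rule vec_eq_iff[THEN iffD2], rule allI)
    fix j
    note cj = continuous_on_harmonic_component[OF F, of j]
    note rep = poisson_formula_dilated[OF cj has_laplacian_harmonic_component[OF F open_ball] r(1,2) x]
    let ?P = "poisson_kernel x"
    let ?C = "(1 - (norm x)\<^sup>2) / (1 - norm x) ^ CARD('n)"
    have Pm: "?P \<in> borel_measurable sphere_measure"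
      by (intro borel_measurable_sphere_measureI poisson_kernel_continuous_sphere x)
    have "(\<lambda>k. LINT w|sphere_measure. ?P w * F (r k *\<^sub>R w) $ j) \<longlonglongrightarrow> (LINT w|sphere_measure. ?P w * (?s w * e $ j))"
    proof (rule integral_dominated_convergence[where w = "\<lambda>w. ?C"])
      show "(\<lambda>w. ?P w * (?s w * e $ j)) \<in> borel_measurable sphere_measure"
        using Pm sgn_inner_measurable_sphere by (intro borel_measurable_times borel_measurable_const)
      show "(\<lambda>w. ?P w * F (r k *\<^sub>R w) $ j) \<in> borel_measurable sphere_measure" for k
        by (rule borel_measurable_times[OF Pm rep(2)])
      show "AE w in sphere_measure. (\<lambda>k. ?P w * F (r k *\<^sub>R w) $ j) \<longlonglongrightarrow> ?P w * (?s w * e $ j)"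
        using AE
      proof eventually_elim
        case (elim w)
        have "(\<lambda>k. F (r k *\<^sub>R w) $ j) \<longlonglongrightarrow> (?s w *\<^sub>R e) $ j" by (rule tendsto_vec_nth[OF elim])
        then show ?case by (intro tendsto_mult tendsto_const) simp
      qed
      show "AE w in sphere_measure. norm (?P w * F (r k *\<^sub>R w) $ j) \<le> ?C" for k
      proof (rule AE_I2)
        fix w :: "real^'n::_" assume "w \<in> space sphere_measure"
        then have w: "norm w = 1" by (simp add: space_sphere_measure)
        have "\<bar>?P w\<bar> * \<bar>F (r k *\<^sub>R w) $ j\<bar> \<le> ?C * 1"
          using poisson_kernel_bounded[OF x w] component_le_norm_cart[of "F (r k *\<^sub>R w)" j] nr[OF w, of k]
          by (intro mult_mono) (auto intro: order_trans[OF abs_ge_zero])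
        then show "norm (?P w * F (r k *\<^sub>R w) $ j) \<le> ?C" by (simp add: abs_mult)
      qed
    qed simp
    moreover have "(LINT w|sphere_measure. ?P w * F (r k *\<^sub>R w) $ j) = F (r k *\<^sub>R x) $ j" for k
      using rep(1)[of k] by (simp add: poisson_integral_kernel)
    moreover have "(\<lambda>k. F (r k *\<^sub>R x) $ j) \<longlonglongrightarrow> F x $ j"
      by (rule tendsto_dilated[OF cj x r(3)])
    ultimately have "F x $ j = (LINT w|sphere_measure. ?P w * (?s w * e $ j))"
      using LIMSEQ_unique by fastforce
    also have "\<dots> = (LINT w|sphere_measure. ?P w * ?s w * e $ j)" by (simp add: mult.assoc)
    also have "\<dots> = (poisson_integral ?s x *\<^sub>R e) $ j" by (simp add: poisson_integral_kernel)
    finally show "F x $ j = (poisson_integral ?s x *\<^sub>R e) $ j" .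
  qed
qed

theorem corollary1:
  fixes F :: "real^'n::{finite,wellorder} \<Rightarrow> real^'k::finite"
    and m :: nat
  assumes "CARD('n) \<ge> 2"
    and "m \<ge> 1" and "CARD('k) = m + 1"
    and "harmonic_mapping_on (ball 0 1) F"
    and "F ` ball 0 1 \<subseteq> ball 0 1"
    and "F 0 = 0"
  shows "(\<forall>x\<in>ball 0 1. norm (F x) \<le> hemisphere_poisson (norm x *\<^sub>R (north_pole :: real^'n::_))) \<and>
    (\<forall>x0\<in>ball 0 1. x0 \<noteq> 0 \<longrightarrow>
      (norm (F x0) = hemisphere_poisson (norm x0 *\<^sub>R (north_pole :: real^'n::_)) \<longleftrightarrow>
        (\<exists>(A :: real^'n::_^'n::_) (e :: real^'k).
          orthogonal_matrix A \<and> x0 v* A = norm x0 *\<^sub>R north_pole \<and> norm e = 1 \<and>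
          (\<forall>x\<in>ball 0 1. F x = hemisphere_poisson (x v* A) *\<^sub>R e))))"
proof -
  note F = assms(4) and F1 = assms(5) and F0 = assms(6)
  let ?U = "\<lambda>x. hemisphere_poisson (norm x *\<^sub>R (north_pole :: real^'n::_))"
  \<comment> \<open>For \<open>v = 0\<close> every unit vector serves, so zeros of \<open>F\<close>
    need no separate case later.\<close>
  have dir: "\<exists>e. norm e = 1 \<and> norm v = inner e v" for v :: "real^'k"
  proof (cases "v = 0")
    case True
    then show ?thesis by (intro exI[of _ "axis undefined 1"]) simp
  next
    case False
    then show ?thesis
      by (intro exI[of _ "sgn v"]) (simp add: norm_sgn, simp add: sgn_div_norm dot_square_norm power2_eq_square)
  qed
  \<comment> \<open>Rotating \<open>x\<close> to a multiple of the pole puts the bound into the form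
    of \<open>harmonic_schwarz\<close>.\<close>
  have U: "?U x = poisson_integral (\<lambda>w. sgn (inner x w)) x" if "norm x < 1" "x \<noteq> 0" for x :: "real^'n::_"
  proof -
    obtain A :: "real^'n::_^'n::_" where A: "orthogonal_matrix A" "x v* A = norm x *\<^sub>R north_pole"
      by (rule orthogonal_matrix_to_north_pole)
    then show ?thesis using hemisphere_poisson_rotated[OF A that(2,1)] by simp
  qed
  have bound: "norm (F x) \<le> ?U x" if "norm x < 1" for x
  proof (cases "x = 0")
    case True
    \<comment> \<open>At the centre the bound is the mean of an odd function, which is 0, as is
      \<open>F 0\<close>.\<close>
    have "hemisphere_poisson (0 :: real^'n::_) = (LINT w|sphere_measure. sgn (inner (north_pole :: real^'n::_) w))"
      unfolding hemisphere_poisson_eq poisson_integral_kernel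
      by (rule Bochner_Integration.integral_cong) (auto simp: poisson_kernel_def space_sphere_measure)
    then show ?thesis using F0 True by (simp add: integral_sgn_inner_sphere)
  next
    case False
    obtain e where e: "norm e = 1" "norm (F x) = inner e (F x)" using dir by blast
    have bd: "\<bar>inner e (F y)\<bar> \<le> 1" if "y \<in> ball 0 1" for y
    proof -
      have "norm (F y) < 1" using F1 that by (auto simp: image_subset_iff)
      then show ?thesis using Cauchy_Schwarz_ineq2[of e "F y"] e(1) by simp
    qed
    have "inner e (F x) \<le> poisson_integral (\<lambda>w. sgn (inner x w)) x"
      by (rule harmonic_schwarz(1)[OF harmonic_mapping_inner[OF F open_ball] bd _ that,
            where \<rho> = "\<lambda>k. real k / real (Suc k)"])
        (use F0 LIMSEQ_n_over_Suc_n in auto)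
    then show ?thesis using e(2) U[OF that False] by simp
  qed
  have "norm (F x0) = ?U x0 \<longleftrightarrow>
        (\<exists>(A :: real^'n::_^'n::_) (e :: real^'k).
          orthogonal_matrix A \<and> x0 v* A = norm x0 *\<^sub>R north_pole \<and> norm e = 1 \<and>
          (\<forall>x\<in>ball 0 1. F x = hemisphere_poisson (x v* A) *\<^sub>R e))" (is "_ \<longleftrightarrow> ?R")
    if x0: "norm x0 < 1" "x0 \<noteq> 0" for x0
  proof
    assume eq: "norm (F x0) = ?U x0"
    obtain e where e: "norm e = 1" "norm (F x0) = inner e (F x0)" using dir by blast
    \<comment> \<open>Any such \<open>A\<close> will do: by
      \<open>hemisphere_poisson_rotated\<close> the resulting function of \<open>x\<close> depends
      only on \<open>x0\<close>.\<close>
    obtain A :: "real^'n::_^'n::_" where A: "orthogonal_matrix A" "x0 v* A = norm x0 *\<^sub>R north_pole"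
      by (rule orthogonal_matrix_to_north_pole)
    have "inner e (F x0) = poisson_integral (\<lambda>w. sgn (inner x0 w)) x0"
      using eq e(2) U[OF x0] by simp
    from harmonic_mapping_schwarz_equality[OF F F1 F0 x0 e(1) this]
    have "F x = hemisphere_poisson (x v* A) *\<^sub>R e" if "x \<in> ball 0 1" for x
      using hemisphere_poisson_rotated[OF A x0(2), of x] that by simp
    then show ?R using A e(1) by blast
  next
    assume ?R
    then obtain A :: "real^'n::_^'n::_" and e :: "real^'k" where
      "x0 v* A = norm x0 *\<^sub>R north_pole" "norm e = 1" "F x0 = hemisphere_poisson (x0 v* A) *\<^sub>R e"
      using x0(1) by force
    then have "norm (F x0) = \<bar>?U x0\<bar>" by simp
    moreover have "0 \<le> ?U x0" using bound[OF x0(1)] norm_ge_zero order_trans by blast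
    ultimately show "norm (F x0) = ?U x0" by simp
  qed
  then show ?thesis using bound by simp
qed

end
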